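(* Let $\Re\alpha>0$. For all $t>0$, the fractional integral of order $\alpha$ of the Bessel function of the second kind with respect to the order is $$D_{\nu-\nu_{0}}^{-\alpha}Y_{\nu}(t)=\frac{1}{\pi}\left\{\int_{0}^{\pi}x^{-\alpha}\,\Im\left(e^{i(t\sin x-\nu x+\pi\alpha/2)}P\left(\alpha,-ix(\nu-\nu_{0})\right)\right)dx-\int_{0}^{\infty}e^{-t\sinh x}\left(e^{\nu x}\frac{P\left(\alpha,x(\nu-\nu_{0})\right)}{x^{\alpha}}+\Re\left[e^{(i\pi-x)\nu}\frac{P\left(\alpha,(i\pi-x)(\nu-\nu_{0})\right)}{(i\pi-x)^{\alpha}}\right]\right)dx\right\}.$$
   Context: $Y_\nu(t)=\frac{J_\nu(t)\cos\pi\nu-J_{-\nu}(t)}{\sin\pi\nu}$ for $\nu\notin\mathbb{Z}$ (extended to integer $\nu$ by taking the limit in $\nu$) is the Bessel function of the second kind, where $J_\nu(t)=\left(\frac t2\right)^{\nu}\sum_{k=0}^{\infty}\frac{(-1)^k(t/2)^{2k}}{k!\,\Gamma(\nu+k+1)}$ is the Bessel function of the first kind. Fractional integration of order $\alpha$, $\Re\alpha>0$, is defined by $$D_{\nu-\nu_0}^{-\alpha}f(\nu)=\frac{1}{\Gamma(\alpha)}\int_{\nu_0}^{\nu}(\nu-\mu)^{\alpha-1}f(\mu)\,d\mu ,$$ and $D_{\nu-\nu_0}^{-\alpha}Y_\nu(t)$ means this with $f(\mu)=Y_\mu(t)$ and $t$ fixed. $P(a,z)=\frac{1}{\Gamma(a)}\int_0^z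 u^{a-1}e^{-u}\,du$, $\Re a>0$, is the regularized lower incomplete gamma function. $\Re$ and $\Im$ denote real and imaginary parts.
   Formalization: Orders are real with ν₀ ≤ ν; the printed formula, false for non-real α, is proved as stated for real α, and for all Re α>0 with Im F, Re F replaced by (F(α)−conj F(conj α))/(2i) and (F(α)+conj F(conj α))/2. *)

theory Defs
  imports "HOL-Complex_Analysis.Complex_Analysis"
begin

(* Meant for t > 0, where (t/2) powr nu is the principal power. The total function rGamma = 1/Gamma
   vanishes at the poles of Gamma, as the series requires for negative integer orders. *)
definition bessel_J :: "complex \<Rightarrow> real \<Rightarrow> complex" where
  "bessel_J \<nu> t = of_real (t / 2) powr \<nu> *
     (\<Sum>k. (-1) ^ k * of_real (t / 2) ^ (2 * k) / fact k * rGamma (\<nu> + of_nat k + 1))"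

definition bessel_Y_quot :: "complex \<Rightarrow> real \<Rightarrow> complex" where
  "bessel_Y_quot \<nu> t =
     (bessel_J \<nu> t * cos (of_real pi * \<nu>) - bessel_J (- \<nu>) t) / sin (of_real pi * \<nu>)"

definition bessel_Y :: "complex \<Rightarrow> real \<Rightarrow> complex" where
  "bessel_Y \<nu> t =
     (if \<nu> \<in> \<int> then Lim (at \<nu>) (\<lambda>\<mu>. bessel_Y_quot \<mu> t) else bessel_Y_quot \<nu> t)"

(* The fractional integral of order \<alpha>, for Re \<alpha> > 0, base point \<nu>0 and \<nu>0 \<le> \<nu>. *)
definition frac_integral :: "real \<Rightarrow> complex \<Rightarrow> (real \<Rightarrow> complex) \<Rightarrow> real \<Rightarrow> complex" where
  "frac_integral \<nu>0 \<alpha> f \<nu> =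
     1 / Gamma \<alpha> * (LBINT \<mu>:{\<nu>0..\<nu>}. of_real (\<nu> - \<mu>) powr (\<alpha> - 1) * f \<mu>)"

(* Meant for Re a > 0; the path of integration from 0 to z is the segment, and the power is the
   principal one, so this is the principal branch in z, cut along the negative real axis. *)
definition reg_lower_gamma :: "complex \<Rightarrow> complex \<Rightarrow> complex" where
  "reg_lower_gamma a z =
     1 / Gamma a * contour_integral (linepath 0 z) (\<lambda>u. u powr (a - 1) * exp (- u))"

(* Real and imaginary part of a function F of the parameter \<alpha>, extended from real to complex \<alpha>:
   if F is holomorphic in \<alpha> on a domain symmetric about the real axis, so are these two functions
   of \<alpha>, and for real \<alpha> they are the usual real and imaginary part of F \<alpha> (lemmas below). *)
definition ext_Re :: "(complex \<Rightarrow> complex) \<Rightarrow> complex \<Rightarrow> complex" where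
  "ext_Re F \<alpha> = (F \<alpha> + cnj (F (cnj \<alpha>))) / 2"

definition ext_Im :: "(complex \<Rightarrow> complex) \<Rightarrow> complex \<Rightarrow> complex" where
  "ext_Im F \<alpha> = (F \<alpha> - cnj (F (cnj \<alpha>))) / (2 * \<i>)"

lemma ext_Re_real: "\<alpha> \<in> \<real> \<Longrightarrow> ext_Re F \<alpha> = of_real (Re (F \<alpha>))"
  by (simp add: ext_Re_def Reals_cnj_iff complex_add_cnj)

lemma ext_Im_real: "\<alpha> \<in> \<real> \<Longrightarrow> ext_Im F \<alpha> = of_real (Im (F \<alpha>))"
  unfolding ext_Im_def Reals_cnj_iff by (simp only:) (simp add: complex_eq_iff)

end

(*
  Hankel's integral for 1/Gamma on a loop through the circle of radius t/2, inserted termwise into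
  the series of J, gives Schlaefli's integral for J and hence, for non-integer real orders mu,
    pi Y_mu(t) = int_0^pi sin (t sin x - mu x) dx
                 - int_0^oo e^(-t sinh x) (e^(mu x) + cos (pi mu) e^(-mu x)) dx.
  Integer orders form a null set and do not matter for the fractional integral. The order enters
  only through exponentials e^(c mu), whose fractional integral is e^(c nu) P(alpha, c (nu - nu0)) / c^alpha
  by the substitution u = c (nu - mu); Fubini's theorem exchanges the two integrations. Real and
  imaginary parts commute with a fractional integral up to conjugation of alpha, which is what
  ext_Re and ext_Im account for.
*)

theory Submission
  imports Defs "HOL-Real_Asymp.Real_Asymp"
begin

section \<open>Termwise integration and Gaussian domination\<close>

text \<open>The radius r = t/2 makes the two series meet: the loop integral of order s + k,
  normalised to r^(s+k) / Gamma(s+k+1), times (-r)^k / k! is exactly the k-th term of J. Summation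
  over k then only turns an exponential series under the integral into an exponential: on the circle
  -r e^(-ix) + r e^(ix) = i t sin x, on the cut r e^(-x) - r e^x = -t sinh x.

  Hankel's formula itself is obtained without deforming a contour. For negative order, circle and
  cut supply the two halves of Euler's integral for Gamma(-s), and the reflection formula finishes.
  The other non-integer orders are reached by a recurrence in s, in which the boundary terms of
  circle and cut cancel at the point -r where they meet.

  All powers are principal. The rates c that occur, namely x, -ix and i pi - x with x > 0, lie off
  the negative axis, and a positive factor nu - mu leaves their argument unchanged, so no cut is
  ever crossed.\<close>

lemma sums_set_integral_exp:
  fixes u f :: "real \<Rightarrow> complex"
  assumes X: "X \<in> sets borel" and f: "set_integrable lborel X f"
    and u [measurable]: "u \<in> borel_measurable borel"
    and K: "\<And>x. x \<in> X \<Longrightarrow> norm (u x) \<le> K"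
  shows "(\<lambda>n. LBINT x:X. u x ^ n / fact n * f x) sums (LBINT x:X. exp (u x) * f x)"
proof -
  define F where "F n x = indicator X x *\<^sub>R (u x ^ n / fact n * f x)" for n x
  define G where "G x = indicator X x *\<^sub>R f x" for x
  have G: "integrable lborel G"
    using f by (simp add: set_integrable_def G_def[abs_def])
  then have [measurable]: "G \<in> borel_measurable lborel" by simp
  have F_eq: "F n x = u x ^ n / fact n * G x" for n x
    by (simp add: F_def G_def)
  \<comment> \<open>The majorants sum to exp K times the norm of \<open>G\<close>, so this one bound
    gives summability both pointwise and of the integrals of the norms.\<close>
  have F_le: "norm (F n x) \<le> K ^ n / fact n * norm (G x)" for n x
  proof (cases "x \<in> X")
    case True
    then have "norm (u x) ^ n \<le> K ^ n"
      by (intro power_mono K) auto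
    then show ?thesis
      by (auto simp: F_eq norm_mult norm_divide norm_power intro!: mult_right_mono divide_right_mono)
  qed (simp add: F_eq G_def)
  have F_int: "integrable lborel (F n)" for n
  proof (rule Bochner_Integration.integrable_bound)
    show "integrable lborel (\<lambda>x. (K ^ n / fact n) *\<^sub>R norm (G x))"
      using G by (intro integrable_scaleR_right integrable_norm)
    show "F n \<in> borel_measurable lborel"
      unfolding F_eq[abs_def] by measurable
    show "AE x in lborel. norm (F n x) \<le> norm ((K ^ n / fact n) *\<^sub>R norm (G x))"
      by (intro AE_I2 order_trans[OF F_le]) (metis abs_ge_self real_norm_def real_scaleR_def)
  qed
  have "summable (\<lambda>n. norm (F n x))" for x
  proof (rule summable_comparison_test')
    show "summable (\<lambda>n. K ^ n / fact n * norm (G x))"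
      using summable_exp_generic[of K] by (intro summable_mult2) (simp add: field_simps)
    show "norm (norm (F n x)) \<le> K ^ n / fact n * norm (G x)" for n
      using F_le by simp
  qed
  moreover have "summable (\<lambda>n. \<integral>x. norm (F n x) \<partial>lborel)"
  proof (rule summable_comparison_test')
    show "summable (\<lambda>n. K ^ n / fact n * (\<integral>x. norm (G x) \<partial>lborel))"
      using summable_exp_generic[of K] by (intro summable_mult2) (simp add: field_simps)
    show "norm (\<integral>x. norm (F n x) \<partial>lborel) \<le> K ^ n / fact n * (\<integral>x. norm (G x) \<partial>lborel)" for n
    proof -
      have "(\<integral>x. norm (F n x) \<partial>lborel) \<le> (\<integral>x. K ^ n / fact n * norm (G x) \<partial>lborel)"
        using F_le F_int G by (intro integral_mono integrable_norm integrable_mult_right) auto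
      then show ?thesis by simp
    qed
  qed
  ultimately have "(\<lambda>n. integral\<^sup>L lborel (F n)) sums (\<integral>x. (\<Sum>n. F n x) \<partial>lborel)"
    using F_int by (intro sums_integral) auto
  moreover have "(\<Sum>n. F n x) = indicator X x *\<^sub>R (exp (u x) * f x)" for x
  proof -
    have "(\<lambda>n. u x ^ n /\<^sub>R fact n * G x) sums (exp (u x) * G x)"
      by (intro sums_mult2 exp_converges)
    then have "(\<lambda>n. F n x) sums (exp (u x) * G x)"
      by (simp add: F_eq scaleR_conv_of_real field_simps)
    then show ?thesis
      by (simp add: sums_iff G_def)
  qed
  ultimately show ?thesis
    by (simp only: set_lebesgue_integral_def F_def[abs_def])
qed

lemma set_integral_exp_minus_Ici:
  fixes a :: real
  assumes "a > 0"
  shows "set_integrable lborel {0..} (\<lambda>x. exp (- a * x))"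
    and "(LBINT x:{0..}. exp (- a * x)) = 1 / a"
proof -
  have 1: "((\<lambda>x. exp (- a * x)) has_integral 1 / a) {0..}"
    using has_integral_exp_minus_to_infinity[OF assms, of 0] by simp
  then have "(\<lambda>x. exp (- a * x)) absolutely_integrable_on {0..}"
    by (intro nonnegative_absolutely_integrable_1) auto
  then have "integrable lebesgue (\<lambda>x. indicator {0..} x *\<^sub>R exp (- a * x))"
    by (simp add: set_integrable_def)
  then show *: "set_integrable lborel {0..} (\<lambda>x. exp (- a * x))"
    unfolding set_integrable_def by (subst (asm) integrable_completion) auto
  show "(LBINT x:{0..}. exp (- a * x)) = 1 / a"
    using set_borel_integral_eq_integral(2)[OF *] 1 by (simp add: integral_unique)
qed

text \<open>Serves the weights \<open>exp (- r * exp x)\<close> and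
  \<open>exp (- t * sinh x)\<close>: a quadratic lower bound for exp or sinh on the half-line is
  enough, since a Gaussian absorbs a linear exponent of either sign.\<close>

lemma set_integrable_Ici_Gaussian_bound:
  fixes f :: "real \<Rightarrow> 'a::{banach, second_countable_topology}"
  assumes [measurable]: "f \<in> borel_measurable borel" and "c > 0"
    and le: "\<And>x. x \<ge> 0 \<Longrightarrow> norm (f x) \<le> exp (m * x - c * x\<^sup>2)"
  shows "set_integrable lborel {0..} f"
proof (rule set_integrable_bound)
  show "set_integrable lborel {0..} (\<lambda>x. exp ((m + 1)\<^sup>2 / (4 * c)) * exp (- 1 * x))"
    by (intro set_integrable_mult_right set_integral_exp_minus_Ici) simp
  show "set_borel_measurable lborel {0..} f"
    unfolding set_borel_measurable_def by measurable
  have "norm (f x) \<le> norm (exp ((m + 1)\<^sup>2 / (4 * c)) * exp (- 1 * x))" if "x \<ge> 0" for x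
  proof -
    \<comment> \<open>Completing the square for m + 1 instead of m leaves over a factor exp(-x),
      which is integrable on the half-line.\<close>
    have "(m + 1) * x - c * x\<^sup>2 = (m + 1)\<^sup>2 / (4 * c) - c * (x - (m + 1) / (2 * c))\<^sup>2"
      using \<open>c > 0\<close> by (simp add: field_simps power2_eq_square)
    also have "\<dots> \<le> (m + 1)\<^sup>2 / (4 * c)"
      using \<open>c > 0\<close> by simp
    finally have "m * x - c * x\<^sup>2 \<le> (m + 1)\<^sup>2 / (4 * c) + - 1 * x"
      by (simp add: algebra_simps)
    then show ?thesis
      using le[OF that] by (simp flip: exp_add) (meson exp_le_cancel_iff order_trans)
  qed
  then show "AE x in lborel. x \<in> {0..} \<longrightarrow>
      norm (f x) \<le> norm (exp ((m + 1)\<^sup>2 / (4 * c)) * exp (- 1 * x))"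
    by auto
qed

section \<open>Hankel's loop integral\<close>

text \<open>
  Hankel's contour for \<open>1 / \<Gamma>(s + 1)\<close> is taken as the circle of radius \<open>r\<close>, in the coordinate
  \<open>r * cis x\<close>, together with both banks of the negative axis, in the coordinate \<open>- r * exp x\<close>.
  A factor \<open>r powr (- s)\<close> is split off throughout.
\<close>

definition hankel_circle :: "real \<Rightarrow> real \<Rightarrow> complex" where
  "hankel_circle r s = (LBINT x:{-pi..pi}. exp (of_real r * cis x) * cis (- s * x))"

definition hankel_cut :: "real \<Rightarrow> real \<Rightarrow> complex" where
  "hankel_cut r s = (LBINT x:{0..}. of_real (exp (- r * exp x - s * x)))"

lemma integrable_hankel_cut:
  fixes r s :: real
  assumes "r > 0"
  shows "set_integrable lborel {0..} (\<lambda>x. exp (- r * exp x - s * x))"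
proof (rule set_integrable_Ici_Gaussian_bound[where c = "r / 2" and m = "- s"])
  fix x :: real assume "x \<ge> 0"
  then have "x\<^sup>2 / 2 \<le> exp x"
    using exp_lower_Taylor_quadratic[of x] by simp
  then have "r * (x\<^sup>2 / 2) \<le> r * exp x"
    using assms by (intro mult_left_mono) auto
  then show "norm (exp (- r * exp x - s * x)) \<le> exp (- s * x - r / 2 * x\<^sup>2)"
    by simp
qed (use assms in auto)

text \<open>The substitution u = r e^x maps the real line onto (0, oo) and sends 0 to r. The half x
  >= 0 is the part of Euler's integral above r; the half x <= 0, reflected, is the part below
  r.\<close>

lemma Gamma_split_integral:
  fixes r p :: real
  assumes "r > 0" "p > 0"
  shows "r powr p * ((LBINT x:{0..}. exp (- r * exp x + p * x)) +
           (LBINT x:{0..}. exp (- r * exp (- x) - p * x))) = Gamma p"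
proof -
  define h where "h x = r powr p * exp (- r * exp x + p * x)" for x
  have Gi: "((\<lambda>t. t powr (p - 1) / exp t) has_integral Gamma p) {0<..}"
  proof -
    have "((\<lambda>t. if t \<in> {0<..} then t powr (p - 1) / exp t else 0) has_integral Gamma p) {0..}"
      by (rule has_integral_spike[OF _ _ Gamma_integral_real[OF assms(2)], of "{0}"]) auto
    then show ?thesis
      by (subst (asm) has_integral_restrict) auto
  qed
  have range: "(\<lambda>x::real. r * exp x) ` UNIV = {0<..}"
  proof (intro equalityI subsetI)
    fix y :: real assume "y \<in> {0<..}"
    then have "y = r * exp (ln (y / r))" using assms by simp
    then show "y \<in> (\<lambda>x. r * exp x) ` UNIV" by blast
  qed (use assms in auto)
  \<comment> \<open>This form of the change of variables carries absolute integrability along with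
    the value; the splitting at 0 needs both.\<close>
  have "(\<lambda>x. \<bar>r * exp x\<bar> * ((r * exp x) powr (p - 1) / exp (r * exp x))) absolutely_integrable_on UNIV \<and>
     integral UNIV (\<lambda>x. \<bar>r * exp x\<bar> * ((r * exp x) powr (p - 1) / exp (r * exp x))) = Gamma p"
  proof (rule has_absolute_integral_change_of_variables_1'[where f = "\<lambda>t. t powr (p - 1) / exp t" and g = "\<lambda>x. r * exp x" and g' = "\<lambda>x. r * exp x", THEN iffD2])
    show "(\<lambda>t. t powr (p - 1) / exp t) absolutely_integrable_on range (\<lambda>x. r * exp x) \<and>
      integral (range (\<lambda>x. r * exp x)) (\<lambda>t. t powr (p - 1) / exp t) = Gamma p"
      unfolding range using Gi
      by (auto intro!: nonnegative_absolutely_integrable_1 simp: integral_unique has_integral_integrable)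
  qed (use assms in \<open>auto intro!: derivative_eq_intros inj_onI\<close>)
  moreover have "\<bar>r * exp x\<bar> * ((r * exp x) powr (p - 1) / exp (r * exp x)) = h x" for x
  proof -
    have "\<bar>r * exp x\<bar> * (r * exp x) powr (p - 1) = (r * exp x) powr p"
      using assms by (simp add: powr_diff)
    also have "\<dots> = r powr p * exp (p * x)"
      using assms by (simp add: powr_mult) (simp add: powr_def)
    finally have "\<bar>r * exp x\<bar> * ((r * exp x) powr (p - 1) / exp (r * exp x)) =
        r powr p * (exp (p * x) / exp (r * exp x))"
      by simp
    also have "exp (p * x) / exp (r * exp x) = exp (- r * exp x + p * x)"
      by (simp flip: exp_diff)
    finally show ?thesis by (simp add: h_def)
  qed
  ultimately have h: "h absolutely_integrable_on UNIV" "integral UNIV h = Gamma p"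
    by simp_all
  have "integrable lebesgue h"
    using h(1) by (simp add: set_integrable_def)
  then have hb: "integrable lborel h"
    by (subst (asm) integrable_completion) (auto simp: h_def[abs_def])
  have hS: "set_integrable lborel S h" if "S \<in> sets borel" for S
    using hb that unfolding set_integrable_def by (intro integrable_mult_indicator) auto
  have "Gamma p = (LBINT x:UNIV. h x)"
    using h(2) set_borel_integral_eq_integral(2)[OF hS[of UNIV]] by simp
  also have "\<dots> = (LBINT x:{0..} \<union> {..0}. h x)"
    by (intro arg_cong2[where f = "set_lebesgue_integral lborel"]) auto
  also have "\<dots> = (LBINT x:{0..}. h x) + (LBINT x:{..0}. h x)"
    using AE_lborel_singleton[of 0] by (intro set_integral_Un_AE hS) auto
  also have "(LBINT x:{..0}. h x) = (LBINT x:{0..}. h (- x))"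
    using set_integral_reflect[of "{..0}" h] by (simp add: atLeast_def)
  also have "(\<lambda>x. h (- x)) = (\<lambda>x. r powr p * exp (- r * exp (- x) - p * x))"
    by (simp add: h_def fun_eq_iff)
  finally show ?thesis
    by (simp add: h_def[abs_def] distrib_left)
qed

lemma set_integral_cis:
  assumes "a \<noteq> 0"
  shows "(LBINT x:{-pi..pi}. cis (a * x)) = of_real (2 * sin (a * pi) / a)"
proof -
  have "((\<lambda>x. exp (\<i> * of_real a * of_real x) / (\<i> * of_real a)) has_vector_derivative
      exp (\<i> * of_real a * of_real x)) (at x within {-pi..pi})" for x
    by (rule has_vector_derivative_real_field[where f = "\<lambda>z. exp (\<i> * of_real a * z) / (\<i> * of_real a)"])
       (use assms in \<open>auto intro!: derivative_eq_intros\<close>)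
  then have "((\<lambda>x. cis (a * x) / (\<i> * of_real a)) has_vector_derivative cis (a * x)) (at x within {-pi..pi})" for x
    by (simp add: cis_conv_exp mult.assoc)
  then have "(LBINT x:{-pi..pi}. cis (a * x)) = cis (a * pi) / (\<i> * of_real a) - cis (a * - pi) / (\<i> * of_real a)"
    unfolding set_lebesgue_integral_def
    by (intro integral_FTC_atLeastAtMost) (auto intro!: continuous_intros)
  also have "\<dots> = of_real (2 * sin (a * pi) / a)"
    using assms by (simp add: complex_eq_iff Re_divide Im_divide power2_eq_square)
  finally show ?thesis .
qed

text \<open>
  For \<open>s < 0\<close> the circle contributes the lower part of the Gamma integral: both have the same
  expansion in the poles \<open>1 / (n - s)\<close> (Prym's decomposition of the Gamma function).
\<close>

lemma hankel_circle_sums: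
  assumes "s \<notin> \<int>"
  shows "(\<lambda>n. - 2 * sin (pi * s) * ((- r) ^ n / fact n / (real n - s))) sums hankel_circle r s"
proof -
  have "(\<lambda>n. LBINT x:{-pi..pi}. (of_real r * cis x) ^ n / fact n * cis (- s * x)) sums hankel_circle r s"
    unfolding hankel_circle_def
    by (rule sums_set_integral_exp[where K = "\<bar>r\<bar>"])
       (auto simp: norm_mult intro!: borel_integrable_atLeastAtMost' continuous_intros
         borel_measurable_continuous_onI)
  moreover have "(LBINT x:{-pi..pi}. (of_real r * cis x) ^ n / fact n * cis (- s * x)) =
      - 2 * sin (pi * s) * ((- r) ^ n / fact n / (real n - s))" for n
  proof -
    have ns: "real n - s \<noteq> 0" using assms by auto
    have "(of_real r * cis x) ^ n / fact n * cis (- s * x) =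
        (of_real r ^ n / fact n) * cis ((real n - s) * x)" for x
      by (simp add: power_mult_distrib Complex.DeMoivre cis_mult left_diff_distrib)
    then have "(LBINT x:{-pi..pi}. (of_real r * cis x) ^ n / fact n * cis (- s * x)) =
        (of_real r ^ n / fact n) * of_real (2 * sin ((real n - s) * pi) / (real n - s))"
      using set_integral_cis[OF ns] by simp
    \<comment> \<open>The parity sign of the sine turns \<open>r ^ n\<close> into
      \<open>(- r) ^ n\<close>, so that the circle matches the expansion of exp(-r e^(-x)).\<close>
    moreover have "sin ((real n - s) * pi) = - ((-1) ^ n * sin (pi * s))"
      by (simp add: left_diff_distrib sin_diff mult.commute[of s])
    moreover have "(- r) ^ n = (-1) ^ n * r ^ n"
      by (rule power_minus)
    ultimately show ?thesis
      by simp
  qed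
  ultimately show ?thesis by simp
qed

text \<open>Up to the factor -2 sin(pi s) this is the series of the circle. For negative s the
  integral of every term converges, including n = 0, where only exp(s x) is left to decay.\<close>

lemma sums_lower_integral:
  assumes "s < 0" "r \<ge> 0"
  shows "(\<lambda>n. complex_of_real ((- r) ^ n / fact n / (real n - s))) sums
     of_real (LBINT x:{0..}. exp (- r * exp (- x) + s * x))"
proof -
  have int: "set_integrable lborel {0..} (\<lambda>x. exp (- (real n - s) * x))" 
     "(LBINT x:{0..}. exp (- (real n - s) * x)) = 1 / (real n - s)" for n
    using assms by (intro set_integral_exp_minus_Ici; simp)+
  \<comment> \<open>The weight exp(s x) is written with \<open>real 0 - s\<close> to be the instance
    n = 0 of the exponentials in \<open>int\<close>.\<close>
  have "(\<lambda>n. LBINT x:{0..}. complex_of_real (- r * exp (- x)) ^ n / fact n * complex_of_real (exp (- (real 0 - s) * x))) sums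
      (LBINT x:{0..}. exp (complex_of_real (- r * exp (- x))) * complex_of_real (exp (- (real 0 - s) * x)))"
  proof (rule sums_set_integral_exp[where K = "r"])
    show "set_integrable lborel {0..} (\<lambda>x. complex_of_real (exp (- (real 0 - s) * x)))"
      using int(1)[of 0] by (simp add: set_integrable_def complex_of_real_integrable_eq scaleR_conv_of_real flip: of_real_mult)
    show "norm (complex_of_real (- r * exp (- x))) \<le> r" if "x \<in> {0..}" for x
      using that assms by (simp add: norm_mult mult_left_le)
  qed auto
  also have "(\<lambda>n. LBINT x:{0..}. complex_of_real (- r * exp (- x)) ^ n / fact n * complex_of_real (exp (- (real 0 - s) * x)))
      = (\<lambda>n. complex_of_real ((- r) ^ n / fact n / (real n - s)))"
  proof
    fix n
    have "complex_of_real (- r * exp (- x)) ^ n / fact n * complex_of_real (exp (- (real 0 - s) * x)) =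
       of_real ((- r) ^ n / fact n * exp (- (real n - s) * x))" for x
    proof -
      have "(- r * exp (- x)) ^ n = (- r) ^ n * exp (- (real n * x))"
        by (simp only: power_mult_distrib exp_of_nat_mult[symmetric]) simp
      moreover have "exp (- (real n * x)) * exp (- (real 0 - s) * x) = exp (- (real n - s) * x)"
        by (simp add: algebra_simps flip: exp_add)
      ultimately have "(- r * exp (- x)) ^ n / fact n * exp (- (real 0 - s) * x) =
          (- r) ^ n / fact n * exp (- (real n - s) * x)"
        by simp
      then have "complex_of_real ((- r * exp (- x)) ^ n / fact n * exp (- (real 0 - s) * x)) =
          of_real ((- r) ^ n / fact n * exp (- (real n - s) * x))"
        by (simp only:)
      then show ?thesis
        by (simp only: of_real_mult of_real_divide of_real_power of_real_fact)
    qed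
    then show "(LBINT x:{0..}. complex_of_real (- r * exp (- x)) ^ n / fact n * complex_of_real (exp (- (real 0 - s) * x)))
      = complex_of_real ((- r) ^ n / fact n / (real n - s))"
      using int(2)[of n] by (simp only: set_integral_complex_of_real set_integral_mult_right) simp
  qed
  also have "(LBINT x:{0..}. exp (complex_of_real (- r * exp (- x))) * complex_of_real (exp (- (real 0 - s) * x))) =
     of_real (LBINT x:{0..}. exp (- r * exp (- x) + s * x))"
    unfolding set_integral_complex_of_real[symmetric]
    by (simp only: exp_of_real of_real_mult[symmetric] exp_add[symmetric]) simp
  finally show ?thesis .
qed

text \<open>This is r^s times the integral of e^u u^(-s-1) / (2 pi i) over the loop that arrives
  from -oo below the negative axis and returns above it. On the banks u^(-s) carries the phases e^(i
  pi s) and e^(-i pi s), whose difference gives the sine.\<close>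

definition hankel_loop :: "real \<Rightarrow> real \<Rightarrow> complex" where
  "hankel_loop r s = hankel_circle r s / (2 * of_real pi) - of_real (sin (pi * s) / pi) * hankel_cut r s"

text \<open>For negative s Euler's integral for Gamma(-s) converges. Circle and cut each contribute
  -sin(pi s) / pi times one of its two parts, and reflection turns -sin(pi s) Gamma(-s) / pi into 1
  / Gamma(s+1).\<close>

lemma hankel_loop_neg:
  assumes "s < 0" "s \<notin> \<int>" "r > 0"
  shows "hankel_loop r s = of_real (r powr s) * rGamma (of_real (s + 1))"
proof -
  define C where "C = (LBINT x:{0..}. exp (- r * exp (- x) + s * x))"
  define B where "B = (LBINT x:{0..}. exp (- r * exp x - s * x))"
  have 1: "hankel_circle r s = of_real (- 2 * sin (pi * s) * C)"
  proof (rule sums_unique2)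
    have "(\<lambda>n. complex_of_real (- 2 * sin (pi * s)) * of_real ((- r) ^ n / fact n / (real n - s)))
       sums (complex_of_real (- 2 * sin (pi * s)) * of_real C)"
      unfolding C_def using assms by (intro sums_mult sums_lower_integral) auto
    then show "(\<lambda>n. complex_of_real (- 2 * sin (pi * s) * ((- r) ^ n / fact n / (real n - s))))
       sums of_real (- 2 * sin (pi * s) * C)"
      by simp
  qed (rule hankel_circle_sums[OF assms(2)])
  have 2: "hankel_cut r s = of_real B"
    by (simp add: hankel_cut_def B_def set_integral_complex_of_real)
  have "r powr (- s) * (B + C) = Gamma (- s)"
    using Gamma_split_integral[of r "- s"] assms by (simp add: B_def C_def)
  then have 3: "B + C = r powr s * Gamma (- s)"
    using assms by (simp add: powr_minus field_simps)
  have G: "Gamma (- s) \<noteq> 0"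
    using assms by (simp add: Gamma_real_pos less_imp_neq[symmetric])
  have "rGamma (complex_of_real (- s)) * rGamma (1 - of_real (- s)) = sin (of_real pi * of_real (- s)) / of_real pi"
    by (rule rGamma_reflection_complex)
  moreover have "rGamma (complex_of_real (- s)) * rGamma (1 - of_real (- s)) = of_real (rGamma (- s) * rGamma (s + 1))"
    by (simp add: rGamma_complex_of_real[symmetric] add.commute)
  moreover have "sin (of_real pi * of_real (- s)) / of_real pi = complex_of_real (- sin (pi * s) / pi)"
    by (simp flip: sin_of_real)
  ultimately have "complex_of_real (rGamma (- s) * rGamma (s + 1)) = of_real (- sin (pi * s) / pi)"
    by (simp only:)
  then have "rGamma (- s) * rGamma (s + 1) = - sin (pi * s) / pi"
    by (simp only: of_real_eq_iff)
  then have 4: "rGamma (s + 1) = - sin (pi * s) / pi * Gamma (- s)"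
    using G by (simp add: Gamma_def field_simps)
  have "hankel_loop r s = of_real (- sin (pi * s) / pi * (B + C))"
    by (simp add: hankel_loop_def 1 2 field_simps)
  also have "\<dots> = of_real (r powr s * rGamma (s + 1))"
    by (simp add: 3 4)
  finally show ?thesis
    by (simp only: rGamma_complex_of_real of_real_mult)
qed

section \<open>Recurrence of the loop integral in the order\<close>

text \<open>Integrates the derivative i (r e^(ix) - s) F of F(x) = exp(r e^(ix)) e^(-isx) over one
  turn. For non-integer s this F is not periodic, so the two ends, both at the point -r of the
  circle, leave a boundary term.\<close>

lemma hankel_circle_recurrence:
  "of_real r * hankel_circle r (s - 1) - of_real s * hankel_circle r s =
     of_real (- 2 * exp (- r) * sin (pi * s))"
proof -
  define F where "F x = exp (of_real r * cis x) * cis (- s * x)" for x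
  define F' where "F' x = \<i> * (of_real r * (exp (of_real r * cis x) * cis (- (s - 1) * x)) - of_real s * F x)" for x
  have "(F has_vector_derivative F' x) (at x within {-pi..pi})" for x
  proof -
    have F: "F x = exp (of_real r * exp (\<i> * of_real x)) * exp (- \<i> * of_real s * of_real x)" for x
      by (simp add: F_def cis_conv_exp mult.assoc)
    have "cis (- (s - 1) * x) = exp (\<i> * of_real x) * exp (- \<i> * of_real s * of_real x)"
      by (simp add: cis_conv_exp algebra_simps flip: exp_add)
    then have "F' x = \<i> * of_real r * exp (\<i> * of_real x) * F x - \<i> * of_real s * F x"
      by (simp add: F'_def F cis_conv_exp algebra_simps)
    then show ?thesis
      unfolding F[abs_def]
      by (intro has_vector_derivative_real_field[where f = "\<lambda>z. exp (of_real r * exp (\<i> * z)) * exp (- \<i> * of_real s * z)"])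
         (auto intro!: derivative_eq_intros simp: algebra_simps)
  qed
  moreover have "continuous_on {-pi..pi} F'"
    unfolding F'_def F_def by (intro continuous_intros)
  ultimately have "(LBINT x:{-pi..pi}. F' x) = F pi - F (- pi)"
    unfolding set_lebesgue_integral_def by (intro integral_FTC_atLeastAtMost) auto
  moreover have "(LBINT x:{-pi..pi}. F' x) =
      \<i> * (of_real r * hankel_circle r (s - 1) - of_real s * hankel_circle r s)"
    unfolding F'_def set_integral_mult_right F_def hankel_circle_def
    by (subst set_integral_diff(2))
       (auto intro!: borel_integrable_atLeastAtMost' continuous_intros set_integrable_mult_right)
  moreover have "F pi - F (- pi) = \<i> * of_real (- 2 * exp (- r) * sin (pi * s))"
    by (simp add: F_def complex_eq_iff Re_exp Im_exp mult.commute)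
  ultimately have "\<i> * (of_real r * hankel_circle r (s - 1) - of_real s * hankel_circle r s) =
      \<i> * of_real (- 2 * exp (- r) * sin (pi * s))"
    by (simp only:)
  then show ?thesis
    by (simp only: mult_cancel_left complex_i_not_zero simp_thms)
qed

text \<open>The counterpart on the cut: the derivative of exp(-r e^x - s x) integrates to minus its
  value at x = 0, which is again the point -r.\<close>

lemma hankel_cut_recurrence:
  assumes "r > 0"
  shows "of_real r * hankel_cut r (s - 1) + of_real s * hankel_cut r s = of_real (exp (- r))"
proof -
  define F where "F x = exp (- r * exp x - s * x)" for x
  define G where "G x = exp (- r * exp x - (s - 1) * x)" for x
  have int: "set_integrable lborel {0..} F" "set_integrable lborel {0..} G"
    using integrable_hankel_cut[OF assms, of s] integrable_hankel_cut[OF assms, of "s - 1"]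
    by (simp_all add: F_def[abs_def] G_def[abs_def])
  have int': "set_integrable lborel {0..} (\<lambda>x. - r * G x - s * F x)"
    using int by (intro set_integral_diff set_integrable_mult_right)
  have lim: "(F \<longlongrightarrow> 0) at_top"
  proof -
    have "F = (\<lambda>x. exp (- (r * exp x + s * x)))" by (simp add: F_def fun_eq_iff)
    moreover have "((\<lambda>x. exp (- (r * exp x + s * x))) \<longlongrightarrow> 0) at_top"
      using assms by real_asymp
    ultimately show ?thesis by simp
  qed
  have "(LBINT x=0..\<infinity>. - r * G x - s * F x) = 0 - F 0"
  proof (rule interval_integral_FTC_integrable)
    show "(F has_vector_derivative - r * G x - s * F x) (at x)" for x
    proof -
      have "exp (- r * exp x - (s - 1) * x) = exp x * exp (- r * exp x - s * x)"
        by (simp add: algebra_simps flip: exp_add)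
      then show ?thesis
        unfolding F_def[abs_def] G_def has_real_derivative_iff_has_vector_derivative[symmetric]
        by (auto intro!: derivative_eq_intros simp: algebra_simps)
    qed
    show "set_integrable lborel (einterval 0 \<infinity>) (\<lambda>x. - r * G x - s * F x)"
      by (rule set_integrable_subset[OF int']) (auto simp: einterval_def)
    show "((F \<circ> real_of_ereal) \<longlongrightarrow> 0) (at_left \<infinity>)"
      using lim by (simp add: ereal_tendsto_simps)
    have "isCont F 0" unfolding F_def[abs_def] by (intro continuous_intros)
    then show "((F \<circ> real_of_ereal) \<longlongrightarrow> F 0) (at_right 0)"
      unfolding zero_ereal_def by (simp add: ereal_tendsto_simps isCont_def filterlim_at_split)
  qed (auto simp: F_def G_def intro!: continuous_intros)
  then have "(LBINT x:{0<..}. - r * G x - s * F x) = - exp (- r)"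
    by (simp add: interval_lebesgue_integral_0_infty F_def)
  moreover have "(LBINT x:{0<..}. - r * G x - s * F x) = (LBINT x:{0..}. - r * G x - s * F x)"
    unfolding set_lebesgue_integral_def
    by (intro integral_cong_AE) (use AE_lborel_singleton[of 0] in \<open>auto simp: F_def[abs_def] G_def[abs_def] indicator_def\<close>)
  moreover have "(LBINT x:{0..}. - r * G x - s * F x) = - r * (LBINT x:{0..}. G x) - s * (LBINT x:{0..}. F x)"
    using int by (subst set_integral_diff(2)) (auto simp only: set_integral_mult_right intro!: set_integrable_mult_right)
  ultimately have "r * (LBINT x:{0..}. G x) + s * (LBINT x:{0..}. F x) = exp (- r)"
    by simp
  then show ?thesis
    by (simp add: hankel_cut_def set_integral_complex_of_real F_def G_def flip: of_real_mult of_real_add)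
qed

text \<open>Lowering s by 1 reverses the sign of sin(pi s), so the cut enters through the sum
  occurring in its own recurrence, and the two boundary terms, both multiples of exp(-r) sin(pi s),
  cancel. The outcome is the functional equation of r^s / Gamma(s+1).\<close>

lemma hankel_loop_recurrence:
  assumes "r > 0"
  shows "of_real s * hankel_loop r s = of_real r * hankel_loop r (s - 1)"
proof -
  have sin: "sin (pi * (s - 1)) = - sin (pi * s)"
    by (simp add: right_diff_distrib sin_diff)
  have "of_real r * hankel_loop r (s - 1) - of_real s * hankel_loop r s =
     (of_real r * hankel_circle r (s - 1) - of_real s * hankel_circle r s) / (2 * of_real pi) +
     of_real (sin (pi * s) / pi) * (of_real r * hankel_cut r (s - 1) + of_real s * hankel_cut r s)"
    by (simp add: hankel_loop_def sin field_simps)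
  also have "\<dots> = 0"
    unfolding hankel_circle_recurrence hankel_cut_recurrence[OF assms] by (simp add: field_simps)
  finally show ?thesis by simp
qed

theorem hankel_loop_rGamma:
  assumes "s \<notin> \<int>" "r > 0"
  shows "hankel_loop r s = of_real (r powr s) * rGamma (of_real (s + 1))"
proof -
  \<comment> \<open>Induction on an upper bound of s: n = 0 is the negative case, and the step
    lowers s by 1 and divides by s, which is nonzero because s is no integer.\<close>
  have "\<forall>s. s < real n \<longrightarrow> s \<notin> \<int> \<longrightarrow> hankel_loop r s = of_real (r powr s) * rGamma (of_real (s + 1))" for n
  proof (induction n)
    case 0
    then show ?case using hankel_loop_neg assms by simp
  next
    case (Suc n)
    show ?case
    proof (intro allI impI)
      fix s :: real assume s: "s < real (Suc n)" "s \<notin> \<int>"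
      then have s': "s - 1 < real n" "s - 1 \<notin> \<int>" "s \<noteq> 0"
        by (auto dest: Ints_add[OF _ Ints_1])
      have "of_real s * hankel_loop r s = of_real r * (of_real (r powr (s - 1)) * rGamma (of_real s))"
        using Suc s' hankel_loop_recurrence[OF assms(2), of s] by auto
      also have "rGamma (complex_of_real s) = of_real s * rGamma (of_real (s + 1))"
        using rGamma_plus1[of "complex_of_real s"] by simp
      also have "of_real r * (of_real (r powr (s - 1)) * (of_real s * rGamma (of_real (s + 1)))) =
          complex_of_real s * (of_real (r powr s) * rGamma (of_real (s + 1)))"
        using assms by (simp add: powr_diff)
      finally show "hankel_loop r s = of_real (r powr s) * rGamma (of_real (s + 1))"
        using s' by simp
    qed
  qed
  moreover obtain n where "s < real n"
    using reals_Archimedean2 by blast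
  ultimately show ?thesis using assms by blast
qed

section \<open>Schlaefli's integrals for the Bessel functions\<close>

lemma integrable_sinh_kernel:
  fixes m t :: real
  assumes "t > 0"
  shows "set_integrable lborel {0..} (\<lambda>x. exp (m * x - t * sinh x))"
\<comment> \<open>For x >= 0, e^x >= 1 + x + x^2/2 and e^(-x) <= 1 give sinh x >= x^2/4; hence the
  constant t/4.\<close>
proof (rule set_integrable_Ici_Gaussian_bound[where c = "t / 4" and m = m])
  fix x :: real assume "x \<ge> 0"
  then have "1 + x + x\<^sup>2 / 2 - 1 \<le> exp x - exp (- x)"
    using exp_lower_Taylor_quadratic[of x] by (intro diff_mono) auto
  then have "x\<^sup>2 / 4 \<le> sinh x"
    using \<open>x \<ge> 0\<close> by (simp add: sinh_field_def)
  then have "t * (x\<^sup>2 / 4) \<le> t * sinh x"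
    using assms by (intro mult_left_mono) auto
  then show "norm (exp (m * x - t * sinh x)) \<le> exp (m * x - t / 4 * x\<^sup>2)"
    by simp
qed (use assms in \<open>auto intro!: borel_measurable_continuous_onI continuous_intros\<close>)

text \<open>The shift by k in the order splits off \<open>cis (- x) ^ k\<close>, which together with
  (-r)^k / k! is the k-th term of exp(-r e^(-ix)).\<close>

lemma hankel_circle_term:
  "(- of_real r) ^ k / fact k * hankel_circle r (s + real k) =
     (LBINT x:{-pi..pi}. (- of_real r * cis (- x)) ^ k / fact k * (exp (of_real r * cis x) * cis (- s * x)))"
proof -
  have "(- of_real r * cis (- x)) ^ k / fact k * (exp (of_real r * cis x) * cis (- s * x)) =
      (- of_real r) ^ k / fact k * (exp (of_real r * cis x) * cis (- (s + real k) * x))" for x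
  proof -
    have "cis (- (s + real k) * x) = cis (- x) ^ k * cis (- s * x)"
      by (simp add: Complex.DeMoivre cis_mult algebra_simps)
    then show ?thesis
      by (simp only: power_mult_distrib times_divide_eq_left times_divide_eq_right ac_simps)
  qed
  then show ?thesis
    by (simp only: hankel_circle_def set_integral_mult_right)
qed

text \<open>Here the shift splits off \<open>exp (- x) ^ k\<close>. The power is one of r and not of
  -r, because sin(pi (s+k)) in front of the cut supplies a second sign (-1)^k.\<close>

lemma hankel_cut_term:
  "(of_real r) ^ k / fact k * hankel_cut r (s + real k) =
     (LBINT x:{0..}. of_real (r * exp (- x)) ^ k / fact k * of_real (exp (- r * exp x - s * x)))"
proof -
  have "complex_of_real (r * exp (- x)) ^ k / fact k * of_real (exp (- r * exp x - s * x)) =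
      of_real r ^ k / fact k * of_real (exp (- r * exp x - (s + real k) * x))" for x
  proof -
    have "exp (- r * exp x - (s + real k) * x) = exp (- x) ^ k * exp (- r * exp x - s * x)"
      by (simp add: distrib_right flip: exp_of_nat_mult exp_add)
    then show ?thesis
      by (simp add: power_mult_distrib del: of_real_exp)
  qed
  then show ?thesis
    by (simp only: hankel_cut_def set_integral_mult_right)
qed

lemma bessel_J_loop_integral:
  fixes s t :: real
  assumes "s \<notin> \<int>" "t > 0"
  shows "bessel_J (of_real s) t =
    (LBINT x:{-pi..pi}. cis (t * sin x - s * x)) / (2 * of_real pi) -
    of_real (sin (pi * s) / pi * (LBINT x:{0..}. exp (- s * x - t * sinh x)))"
proof -
  define r where "r = t / 2"
  have r: "r > 0" using assms by (simp add: r_def)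
  have "(\<lambda>k. LBINT x:{-pi..pi}. (- of_real r * cis (- x)) ^ k / fact k * (exp (of_real r * cis x) * cis (- s * x)))
      sums (LBINT x:{-pi..pi}. exp (- of_real r * cis (- x)) * (exp (of_real r * cis x) * cis (- s * x)))"
    by (rule sums_set_integral_exp[where K = "r"])
       (use r in \<open>auto simp: norm_mult intro!: borel_integrable_atLeastAtMost' continuous_intros
         borel_measurable_continuous_onI\<close>)
  moreover have "exp (- of_real r * cis (- x)) * (exp (of_real r * cis x) * cis (- s * x)) = cis (t * sin x - s * x)" for x
  proof -
    have "- of_real r * cis (- x) + of_real r * cis x = \<i> * of_real (t * sin x)"
      by (simp add: complex_eq_iff r_def)
    then have "exp (- of_real r * cis (- x)) * exp (of_real r * cis x) = cis (t * sin x)"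
      by (simp add: cis_conv_exp flip: exp_add)
    then show ?thesis
      by (simp add: cis_mult flip: mult.assoc)
  qed
  ultimately have 1: "(\<lambda>k. (- of_real r) ^ k / fact k * hankel_circle r (s + real k)) sums
      (LBINT x:{-pi..pi}. cis (t * sin x - s * x))"
    by (simp only: hankel_circle_term)
  have "(\<lambda>k. LBINT x:{0..}. of_real (r * exp (- x)) ^ k / fact k * complex_of_real (exp (- r * exp x - s * x)))
      sums (LBINT x:{0..}. exp (of_real (r * exp (- x))) * complex_of_real (exp (- r * exp x - s * x)))"
  proof (rule sums_set_integral_exp[where K = "r"])
    show "set_integrable lborel {0..} (\<lambda>x. complex_of_real (exp (- r * exp x - s * x)))"
      using integrable_hankel_cut[OF r, of s]
      by (simp add: set_integrable_def complex_of_real_integrable_eq scaleR_conv_of_real flip: of_real_mult)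
    show "norm (complex_of_real (r * exp (- x))) \<le> r" if "x \<in> {0..}" for x
      using that r by (simp add: norm_mult mult_left_le)
  qed auto
  moreover have "exp (of_real (r * exp (- x))) * complex_of_real (exp (- r * exp x - s * x)) =
      of_real (exp (- s * x - t * sinh x))" for x
  proof -
    have "r * exp (- x) + (- r * exp x - s * x) = - s * x - t * sinh x"
      by (simp add: sinh_def r_def field_simps)
    then show ?thesis
      by (simp only: exp_of_real of_real_mult[symmetric] exp_add[symmetric])
  qed
  ultimately have 2: "(\<lambda>k. of_real r ^ k / fact k * hankel_cut r (s + real k)) sums
      of_real (LBINT x:{0..}. exp (- s * x - t * sinh x))"
    by (simp only: hankel_cut_term set_integral_complex_of_real)
  have "(\<lambda>k. (- of_real r) ^ k / fact k * hankel_circle r (s + real k) / (2 * of_real pi) -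
       of_real (sin (pi * s) / pi) * (of_real r ^ k / fact k * hankel_cut r (s + real k))) sums
     ((LBINT x:{-pi..pi}. cis (t * sin x - s * x)) / (2 * of_real pi) -
       of_real (sin (pi * s) / pi) * of_real (LBINT x:{0..}. exp (- s * x - t * sinh x)))"
    by (intro sums_diff sums_divide sums_mult 1 2)
  moreover have "(- of_real r) ^ k / fact k * hankel_circle r (s + real k) / (2 * of_real pi) -
       of_real (sin (pi * s) / pi) * (of_real r ^ k / fact k * hankel_cut r (s + real k)) =
     of_real r powr of_real s * ((-1) ^ k * of_real r ^ (2 * k) / fact k * rGamma (of_real s + of_nat k + 1))" for k
  proof -
    have "s + real k \<notin> \<int>"
      using assms(1) by (metis Ints_diff Ints_of_nat add_diff_cancel_right')
    from hankel_loop_rGamma[OF this r]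
    have L: "hankel_loop r (s + real k) = of_real (r powr s * r ^ k) * rGamma (of_real s + of_nat k + 1)"
      using r by (simp add: powr_add powr_realpow)
    have "sin (pi * (s + real k)) = (-1) ^ k * sin (pi * s)"
      by (simp add: distrib_left sin_add mult.commute[of pi "real k"])
    then have "(- of_real r) ^ k / fact k * hankel_circle r (s + real k) / (2 * of_real pi) -
       of_real (sin (pi * s) / pi) * (of_real r ^ k / fact k * hankel_cut r (s + real k)) =
       (- of_real r) ^ k / fact k * hankel_loop r (s + real k)"
    proof -
      \<comment> \<open>One of the two inserted signs goes to r^k, the other to the sine, which
        thereby becomes the one of order s + k.\<close>
      have "(- 1) ^ k * (- 1) ^ k = (1 :: complex)"
        by (simp flip: power_mult_distrib)
      then have "of_real (sin (pi * s) / pi) * (of_real r ^ k / fact k * hankel_cut r (s + real k)) =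
        (- 1) ^ k * (- 1) ^ k * (of_real (sin (pi * s) / pi) * (of_real r ^ k / fact k * hankel_cut r (s + real k)))"
        by simp
      also have "\<dots> = (- of_real r) ^ k / fact k * (of_real ((- 1) ^ k * sin (pi * s) / pi) * hankel_cut r (s + real k))"
        by (simp only: power_minus[of "complex_of_real r"] of_real_mult of_real_divide of_real_power
            of_real_minus of_real_1 times_divide_eq_left times_divide_eq_right divide_divide_eq_left ac_simps)
      finally show ?thesis
        using \<open>sin (pi * (s + real k)) = (-1) ^ k * sin (pi * s)\<close>
        by (simp add: hankel_loop_def right_diff_distrib)
    qed
    also have "\<dots> = of_real r powr of_real s * ((-1) ^ k * of_real r ^ (2 * k) / fact k * rGamma (of_real s + of_nat k + 1))"
      using r by (simp add: L power_minus[of "complex_of_real r"] powr_of_real mult_2 power_add)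
    finally show ?thesis .
  qed
  ultimately have "(\<lambda>k. of_real r powr of_real s * ((-1) ^ k * of_real r ^ (2 * k) / fact k * rGamma (of_real s + of_nat k + 1))) sums
     ((LBINT x:{-pi..pi}. cis (t * sin x - s * x)) / (2 * of_real pi) -
       of_real (sin (pi * s) / pi) * of_real (LBINT x:{0..}. exp (- s * x - t * sinh x)))"
    by (simp only:)
  \<comment> \<open>\<open>bessel_J\<close> keeps this power outside its infinite sum; dividing by
    it yields the value of the bare series.\<close>
  moreover have "complex_of_real r powr of_real s \<noteq> 0"
    using r by simp
  ultimately have "(\<lambda>k. (-1) ^ k * of_real r ^ (2 * k) / fact k * rGamma (of_real s + of_nat k + 1)) sums
     (((LBINT x:{-pi..pi}. cis (t * sin x - s * x)) / (2 * of_real pi) -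
       of_real (sin (pi * s) / pi) * of_real (LBINT x:{0..}. exp (- s * x - t * sinh x))) / of_real r powr of_real s)"
    by (intro sums_mult_D) auto
  then have "(\<Sum>k. (-1) ^ k * of_real r ^ (2 * k) / fact k * rGamma (of_real s + of_nat k + 1)) =
     (((LBINT x:{-pi..pi}. cis (t * sin x - s * x)) / (2 * of_real pi) -
       of_real (sin (pi * s) / pi) * of_real (LBINT x:{0..}. exp (- s * x - t * sinh x))) / of_real r powr of_real s)"
    by (rule sums_unique[symmetric])
  then show ?thesis
    using \<open>complex_of_real r powr of_real s \<noteq> 0\<close> by (simp add: bessel_J_def r_def)
qed

text \<open>The phase t sin x - s x is odd in x, so folding the symmetric interval onto its right
  half doubles the cosine and cancels the sine.\<close>

lemma bessel_J_Schlaefli: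
  fixes s t :: real
  assumes "s \<notin> \<int>" "t > 0"
  shows "bessel_J (of_real s) t = of_real ((LBINT x:{0..pi}. cos (t * sin x - s * x)) / pi -
    sin (pi * s) / pi * (LBINT x:{0..}. exp (- s * x - t * sinh x)))"
proof -
  define c where "c x = cis (t * sin x - s * x)" for x
  have int: "set_integrable lborel {a..b} c" for a b
    unfolding c_def by (intro borel_integrable_atLeastAtMost' continuous_intros)
  have int': "set_integrable lborel {a..b} (\<lambda>x. c (- x))" for a b
    unfolding c_def by (intro borel_integrable_atLeastAtMost' continuous_intros)
  have "(LBINT x:{-pi..pi}. c x) = (LBINT x:{0..pi} \<union> {-pi..0}. c x)"
    by (intro arg_cong2[where f = "set_lebesgue_integral lborel"]) auto
  also have "\<dots> = (LBINT x:{0..pi}. c x) + (LBINT x:{-pi..0}. c x)"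
    using AE_lborel_singleton[of 0] by (intro set_integral_Un_AE int) auto
  also have "(LBINT x:{-pi..0}. c x) = (LBINT x:{0..pi}. c (- x))"
  proof -
    have "{x. - x \<in> {-pi..0}} = {0..pi}" by auto
    then show ?thesis using set_integral_reflect[of "{-pi..0}" c] by simp
  qed
  also have "(LBINT x:{0..pi}. c x) + (LBINT x:{0..pi}. c (- x)) = (LBINT x:{0..pi}. c x + c (- x))"
    using int int' by (simp add: set_integral_add(2))
  also have "(\<lambda>x. c x + c (- x)) = (\<lambda>x. of_real (2 * cos (t * sin x - s * x)))"
  proof
    fix x
    have "cos (s * x - t * sin x) = cos (t * sin x - s * x)" "sin (s * x - t * sin x) = - sin (t * sin x - s * x)"
      by (metis cos_minus minus_diff_eq, metis sin_minus minus_diff_eq)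
    then show "c x + c (- x) = of_real (2 * cos (t * sin x - s * x))"
      by (simp add: c_def complex_eq_iff)
  qed
  finally show ?thesis
    using bessel_J_loop_integral[OF assms] by (simp add: c_def set_integral_complex_of_real)
qed

text \<open>The reflection of x to pi - x fixes sin x and turns the phase of J_(-s) into pi s plus
  the phase of J_s. By the addition theorem the cosine integrals then cancel in the quotient
  defining Y, and what remains of them is the sine integral, freed of its factor sin(pi s) by the
  denominator.\<close>

theorem bessel_Y_Schlaefli:
  fixes s t :: real
  assumes "s \<notin> \<int>" "t > 0"
  shows "bessel_Y (of_real s) t = of_real (((LBINT x:{0..pi}. sin (t * sin x - s * x)) -
     (LBINT x:{0..}. exp (- t * sinh x) * (exp (s * x) + cos (pi * s) * exp (- s * x)))) / pi)"
proof -
  define Ic where "Ic = (LBINT x:{0..pi}. cos (t * sin x - s * x))"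
  define Is where "Is = (LBINT x:{0..pi}. sin (t * sin x - s * x))"
  define E where "E s = (LBINT x:{0..}. exp (- s * x - t * sinh x))" for s
  have neg: "- s \<notin> \<int>" using assms(1) by (metis Ints_minus minus_minus)
  have "complex_of_real s \<notin> \<int>" using assms(1) by simp
  have "sin (pi * s) \<noteq> 0"
    using assms(1) by (auto simp: sin_zero_iff_int2)
  have "(LBINT x:{0..pi}. cos (t * sin x - (- s) * x)) = (LBINT x:{0..pi}. cos (t * sin (pi - x) - (- s) * (pi - x)))"
  proof -
    have "indicator {0..pi} (pi + - 1 * x) = (indicator {0..pi} x :: real)" for x
      by (auto simp: indicator_def)
    then show ?thesis
      unfolding set_lebesgue_integral_def
      by (subst lborel_integral_real_affine[where c = "-1" and t = pi]) auto
  qed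
  also have "\<dots> = (LBINT x:{0..pi}. cos (pi * s) * cos (t * sin x - s * x) - sin (pi * s) * sin (t * sin x - s * x))"
  proof (intro set_lebesgue_integral_cong allI impI)
    fix x
    have "t * sin (pi - x) - (- s) * (pi - x) = pi * s + (t * sin x - s * x)"
      by (simp add: algebra_simps)
    then show "cos (t * sin (pi - x) - (- s) * (pi - x)) =
        cos (pi * s) * cos (t * sin x - s * x) - sin (pi * s) * sin (t * sin x - s * x)"
      by (simp only: cos_add)
  qed auto
  also have "\<dots> = cos (pi * s) * Ic - sin (pi * s) * Is"
    unfolding Ic_def Is_def
    by (subst set_integral_diff(2)) (auto intro!: borel_integrable_atLeastAtMost' continuous_intros)
  finally have 1: "bessel_J (- of_real s) t = of_real ((cos (pi * s) * Ic - sin (pi * s) * Is) / pi + sin (pi * s) / pi * E (- s))"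
    using bessel_J_Schlaefli[OF neg assms(2)] by (simp add: E_def)
  have 2: "bessel_J (of_real s) t = of_real (Ic / pi - sin (pi * s) / pi * E s)"
    using bessel_J_Schlaefli[OF assms] by (simp add: E_def Ic_def)
  have "(LBINT x:{0..}. exp (- t * sinh x) * (exp (s * x) + cos (pi * s) * exp (- s * x))) =
      (LBINT x:{0..}. exp (- (- s) * x - t * sinh x) + cos (pi * s) * exp (- s * x - t * sinh x))"
    by (intro set_lebesgue_integral_cong) (auto simp: algebra_simps exp_diff exp_minus exp_add divide_simps)
  also have "\<dots> = E (- s) + cos (pi * s) * E s"
    unfolding E_def using assms(2)
    by (subst set_integral_add(2)[OF integrable_sinh_kernel set_integrable_mult_right[OF integrable_sinh_kernel]]) auto
  finally have 3: "(LBINT x:{0..}. exp (- t * sinh x) * (exp (s * x) + cos (pi * s) * exp (- s * x))) = E (- s) + cos (pi * s) * E s" .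
  have "bessel_Y (of_real s) t = of_real (((Ic / pi - sin (pi * s) / pi * E s) * cos (pi * s) -
     ((cos (pi * s) * Ic - sin (pi * s) * Is) / pi + sin (pi * s) / pi * E (- s))) / sin (pi * s))"
    using \<open>complex_of_real s \<notin> \<int>\<close> unfolding bessel_Y_def bessel_Y_quot_def 1 2
    by (simp flip: cos_of_real sin_of_real)
  also have "((Ic / pi - sin (pi * s) / pi * E s) * cos (pi * s) -
     ((cos (pi * s) * Ic - sin (pi * s) * Is) / pi + sin (pi * s) / pi * E (- s))) / sin (pi * s) =
     (Is - (E (- s) + cos (pi * s) * E s)) / pi"
    using \<open>sin (pi * s) \<noteq> 0\<close> by (simp add: field_simps)
  finally show ?thesis
    by (simp only: 3 Is_def)
qed

section \<open>Fractional integrals\<close>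

lemma set_integrable_powr_left:
  fixes a L :: real
  assumes "a > 0" "L \<ge> 0"
  shows "set_integrable lborel {0..L} (\<lambda>s. s powr (a - 1))"
proof -
  have "(\<lambda>s. s powr (a - 1)) integrable_on {0..L}"
    using has_integral_powr_from_0[of "a - 1" L] assms by (auto simp: integrable_on_def)
  then have "(\<lambda>s. s powr (a - 1)) absolutely_integrable_on {0..L}"
    by (intro nonnegative_absolutely_integrable_1) auto
  then have "integrable lebesgue (\<lambda>s. indicator {0..L} s *\<^sub>R s powr (a - 1))"
    by (simp add: set_integrable_def)
  then show ?thesis
    unfolding set_integrable_def by (subst (asm) integrable_completion) auto
qed

text \<open>As a function of a real base the power may be discontinuous at 0, so measurability is
  read off an explicit formula on three pieces. The value at 0 is 0, and a negative base has
  argument +pi.\<close>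

lemma borel_measurable_powr_of_real [measurable]:
  "(\<lambda>s::real. of_real s powr (c::complex)) \<in> borel_measurable borel"
proof -
  have "(\<lambda>s::real. complex_of_real s powr c) =
     (\<lambda>s. if s > 0 then exp (c * of_real (ln s)) else if s = 0 then 0 else exp (c * (of_real (ln (- s)) + of_real pi * \<i>)))"
    by (auto simp: fun_eq_iff powr_def Ln_of_real')
  then show ?thesis by simp
qed

lemma norm_of_real_powr:
  "s \<ge> 0 \<Longrightarrow> norm (of_real s powr (c::complex)) = s powr Re c"
  by (simp add: norm_powr_real_powr)

lemma set_integrable_of_real_powr:
  assumes "Re \<alpha> > 0" "L \<ge> 0"
  shows "set_integrable lborel {0..L} (\<lambda>s. complex_of_real s powr (\<alpha> - 1))"
proof (rule set_integrable_bound)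
  show "set_integrable lborel {0..L} (\<lambda>s. s powr (Re \<alpha> - 1))"
    using assms by (intro set_integrable_powr_left) auto
  show "set_borel_measurable lborel {0..L} (\<lambda>s. complex_of_real s powr (\<alpha> - 1))"
    unfolding set_borel_measurable_def by measurable
qed (auto simp: norm_of_real_powr)

lemma set_integrable_of_real_powr_diff:
  fixes \<alpha> :: complex and \<nu>0 \<nu> :: real
  assumes "Re \<alpha> > 0" "\<nu>0 \<le> \<nu>"
  shows "set_integrable lborel {\<nu>0..\<nu>} (\<lambda>\<mu>. of_real (\<nu> - \<mu>) powr (\<alpha> - 1))"
proof -
  have "set_integrable lborel {0..\<nu> - \<nu>0} (\<lambda>s. complex_of_real s powr (\<alpha> - 1))"
    using assms by (intro set_integrable_of_real_powr) auto
  then have "integrable lborel (\<lambda>\<mu>. indicator {0..\<nu> - \<nu>0} (\<nu> + - 1 * \<mu>) *\<^sub>R (of_real (\<nu> + - 1 * \<mu>) powr (\<alpha> - 1)))"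
    unfolding set_integrable_def by (rule lborel_integrable_real_affine) simp
  moreover have "indicator {0..\<nu> - \<nu>0} (\<nu> + - 1 * \<mu>) = (indicator {\<nu>0..\<nu>} \<mu> :: real)" for \<mu>
    by (auto simp: indicator_def)
  ultimately show ?thesis
    by (simp add: set_integrable_def)
qed

lemma set_integrable_mult_continuous:
  fixes w f :: "real \<Rightarrow> complex"
  assumes w: "set_integrable lborel {a..b} w" and f: "continuous_on {a..b} f"
  shows "set_integrable lborel {a..b} (\<lambda>x. w x * f x)"
proof -
  have "bounded (f ` {a..b})"
    using f by (intro compact_imp_bounded compact_continuous_image) auto
  then obtain B where B: "\<And>x. x \<in> {a..b} \<Longrightarrow> norm (f x) \<le> B"
    unfolding bounded_iff by blast
  have [measurable]: "(\<lambda>x. indicator {a..b} x *\<^sub>R w x) \<in> borel_measurable borel"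
      "(\<lambda>x. indicator {a..b} x *\<^sub>R f x) \<in> borel_measurable borel"
    using w f by (auto simp: set_integrable_def dest: borel_measurable_integrable
        intro: borel_measurable_continuous_on_indicator)
  show ?thesis
  proof (rule set_integrable_bound)
    show "set_integrable lborel {a..b} (\<lambda>x. of_real B * w x)"
      using w by (rule set_integrable_mult_right)
    \<comment> \<open>Only the functions cut off to the segment are known to be measurable; the
      indicator is idempotent, so it may stand at both factors.\<close>
    have "(\<lambda>x. (indicator {a..b} x *\<^sub>R w x) * (indicator {a..b} x *\<^sub>R f x)) \<in> borel_measurable borel"
      by measurable
    also have "(\<lambda>x. (indicator {a..b} x *\<^sub>R w x) * (indicator {a..b} x *\<^sub>R f x)) =
        (\<lambda>x. indicator {a..b} x *\<^sub>R (w x * f x))"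
      by (auto simp: indicator_def)
    finally show "set_borel_measurable lborel {a..b} (\<lambda>x. w x * f x)"
      by (simp add: set_borel_measurable_def)
    have "norm (w x * f x) \<le> norm (of_real B * w x)" if "x \<in> {a..b}" for x
    proof -
      have "norm (w x) * norm (f x) \<le> norm (w x) * \<bar>B\<bar>"
        using B[OF that] by (intro mult_left_mono) auto
      then show ?thesis by (simp add: norm_mult mult.commute)
    qed
    then show "AE x in lborel. x \<in> {a..b} \<longrightarrow> norm (w x * f x) \<le> norm (of_real B * w x)"
      by simp
  qed
qed

text \<open>With s = nu - mu the substitution u = c s stays on one ray, so the principal powers of c
  s and of c differ only by a power of the positive number s. This holds for every nonzero c, even
  for c on the cut, as \<open>c powr \<alpha>\<close> and the incomplete gamma function use the same
  branch.\<close>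

lemma frac_integral_exp:
  fixes \<alpha> c :: complex and \<nu>0 \<nu> :: real
  assumes "Re \<alpha> > 0" "\<nu>0 \<le> \<nu>" "c \<noteq> 0"
  shows "frac_integral \<nu>0 \<alpha> (\<lambda>\<mu>. exp (c * of_real \<mu>)) \<nu> =
    exp (c * of_real \<nu>) * (reg_lower_gamma \<alpha> (c * of_real (\<nu> - \<nu>0)) / c powr \<alpha>)"
\<comment> \<open>Scaling by the length L of the segment needs L > 0; for length 0 both sides
  vanish.\<close>
proof (cases "\<nu> = \<nu>0")
  case True
  have "(LBINT \<mu>:{\<nu>}. of_real (\<nu> - \<mu>) powr (\<alpha> - 1) * exp (c * of_real \<mu>)) = 0"
    using set_lebesgue_integral_cong[of "{\<nu>}" lborel "\<lambda>\<mu>. of_real (\<nu> - \<mu>) powr (\<alpha> - 1) * exp (c * of_real \<mu>)" "\<lambda>_. 0"]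
    by simp
  then show ?thesis
    using True by (simp add: frac_integral_def reg_lower_gamma_def)
next
  case False
  define L where "L = \<nu> - \<nu>0"
  have L: "L > 0" using assms False by (simp add: L_def)
  define g where "g s = of_real s powr (\<alpha> - 1) * exp (- (c * of_real s))" for s :: real
  have g_int: "set_integrable lborel {0..L} g"
    unfolding g_def using assms(1) L
    by (intro set_integrable_mult_continuous set_integrable_of_real_powr continuous_intros) auto
  have "(LBINT \<mu>:{\<nu>0..\<nu>}. of_real (\<nu> - \<mu>) powr (\<alpha> - 1) * exp (c * of_real \<mu>)) =
     (LBINT s:{0..L}. exp (c * of_real \<nu>) * g s)"
  proof -
    have 1: "indicator {\<nu>0..\<nu>} (\<nu> + - 1 * s) = (indicator {0..L} s :: real)" for s
      by (auto simp: indicator_def L_def)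
    have 2: "exp (c * of_real (\<nu> + - 1 * s)) = exp (c * of_real \<nu>) * exp (- (c * complex_of_real s))" for s
      by (simp add: algebra_simps flip: exp_add)
    show ?thesis
      unfolding set_lebesgue_integral_def g_def
      by (subst lborel_integral_real_affine[where c = "-1" and t = \<nu>], simp)
         (simp only: 1 2, simp add: mult_ac)
  qed
  then have lhs: "frac_integral \<nu>0 \<alpha> (\<lambda>\<mu>. exp (c * of_real \<mu>)) \<nu> =
      1 / Gamma \<alpha> * (exp (c * of_real \<nu>) * (LBINT s:{0..L}. g s))"
    by (simp add: frac_integral_def)
  define z where "z = c * of_real L"
  have powr_scale: "(c * of_real s) powr (\<alpha> - 1) * c = c powr \<alpha> * of_real s powr (\<alpha> - 1)" if "s \<ge> 0" for s
  proof (cases "s = 0")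
    case False
    then have "s > 0" using that by simp
    then have "Ln (c * of_real s) = Ln c + of_real (ln s)"
      using Ln_times_of_real[of s c] assms by (simp add: mult.commute Ln_of_real)
    then have "(c * of_real s) powr (\<alpha> - 1) = c powr (\<alpha> - 1) * of_real s powr (\<alpha> - 1)"
      using \<open>s > 0\<close> assms by (simp add: powr_def Ln_of_real distrib_left exp_add)
    then show ?thesis
      using assms by (simp add: powr_diff)
  qed simp
  have "contour_integral (linepath 0 z) (\<lambda>u. u powr (\<alpha> - 1) * exp (- u)) =
      integral {0..1} (\<lambda>x. (of_real x * z) powr (\<alpha> - 1) * exp (- (of_real x * z)) * z)"
    by (simp add: contour_integral_integral linepath_def scaleR_conv_of_real)
  also have "\<dots> = integral {0..1} (\<lambda>x. c powr \<alpha> * (L *\<^sub>R g (L * x)))"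
  proof (rule integral_cong)
    fix x :: real assume "x \<in> {0..1}"
    then have "(c * of_real (L * x)) powr (\<alpha> - 1) * c = c powr \<alpha> * of_real (L * x) powr (\<alpha> - 1)"
      using L by (intro powr_scale) simp
    then show "(of_real x * z) powr (\<alpha> - 1) * exp (- (of_real x * z)) * z = c powr \<alpha> * (L *\<^sub>R g (L * x))"
      by (simp add: z_def g_def scaleR_conv_of_real mult_ac)
  qed
  \<comment> \<open>The contour integral is a gauge integral. It agrees with the Lebesgue integral
    because the singularity at 0 is absolutely integrable for
    \<open>Re \<alpha> > 0\<close>.\<close>
  also have "\<dots> = (LBINT x:{0..1}. c powr \<alpha> * (L *\<^sub>R g (L * x)))"
  proof (rule set_borel_integral_eq_integral(2)[symmetric])
    have "integrable lborel (\<lambda>x. indicator {0..L} (0 + L * x) *\<^sub>R g (0 + L * x))"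
      using g_int L unfolding set_integrable_def by (intro lborel_integrable_real_affine) auto
    moreover have "indicator {0..L} (0 + L * x) = (indicator {0..1} x :: real)" for x
      using L by (auto simp: indicator_def zero_le_mult_iff)
    ultimately show "set_integrable lborel {0..1} (\<lambda>x. c powr \<alpha> * (L *\<^sub>R g (L * x)))"
      unfolding set_integrable_def[symmetric] 
      by (intro set_integrable_mult_right set_integrable_scaleR_right) (simp add: set_integrable_def)
  qed
  also have "\<dots> = c powr \<alpha> * (LBINT s:{0..L}. g s)"
  proof -
    have "indicator {0..L} (0 + L * x) = (indicator {0..1} x :: real)" for x
      using L by (auto simp: indicator_def zero_le_mult_iff)
    then have "(LBINT s:{0..L}. g s) = L *\<^sub>R (LBINT x:{0..1}. g (L * x))"
      using L unfolding set_lebesgue_integral_def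
      by (subst lborel_integral_real_affine[where c = L and t = 0]) auto
    then show ?thesis by simp
  qed
  finally have "reg_lower_gamma \<alpha> z = 1 / Gamma \<alpha> * (c powr \<alpha> * (LBINT s:{0..L}. g s))"
    by (simp add: reg_lower_gamma_def)
  then show ?thesis
    using assms(3) by (simp add: lhs z_def L_def)
qed

text \<open>The bound \<open>h\<close> is uniform in the order, so its product with the norm of the
  weight is integrable on the product space and Fubini applies. The last two conclusions ensure that
  the outer integrals are genuine and not the default value 0; the third also allows a difference of
  fractional integrals to be split.\<close>

lemma frac_integral_swap:
  fixes k :: "real \<Rightarrow> real \<Rightarrow> complex"
  assumes "Re \<alpha> > 0" "\<nu>0 \<le> \<nu>" and [measurable]: "X \<in> sets borel"
    and [measurable]: "case_prod k \<in> borel_measurable (borel \<Otimes>\<^sub>M borel)"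
    and h: "set_integrable lborel X h"
    and le: "\<And>x \<mu>. x \<in> X \<Longrightarrow> \<mu> \<in> {\<nu>0..\<nu>} \<Longrightarrow> norm (k x \<mu>) \<le> h x"
  shows "frac_integral \<nu>0 \<alpha> (\<lambda>\<mu>. LBINT x:X. k x \<mu>) \<nu> = (LBINT x:X. frac_integral \<nu>0 \<alpha> (k x) \<nu>)"
    and "set_integrable lborel X (\<lambda>x. frac_integral \<nu>0 \<alpha> (k x) \<nu>)"
    and "set_integrable lborel {\<nu>0..\<nu>} (\<lambda>\<mu>. of_real (\<nu> - \<mu>) powr (\<alpha> - 1) * (LBINT x:X. k x \<mu>))"
proof -
  define w where "w \<mu> = indicator {\<nu>0..\<nu>} \<mu> *\<^sub>R (complex_of_real (\<nu> - \<mu>) powr (\<alpha> - 1))" for \<mu>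
  define H where "H x = indicator X x *\<^sub>R h x" for x
  define f where "f x \<mu> = w \<mu> * (indicator X x *\<^sub>R k x \<mu>)" for x \<mu>
  have w: "integrable lborel w"
    using set_integrable_of_real_powr_diff[OF assms(1,2)] by (simp add: w_def[abs_def] set_integrable_def)
  have H: "integrable lborel H"
    using h by (simp add: H_def[abs_def] set_integrable_def)
  have [measurable]: "w \<in> borel_measurable borel" "H \<in> borel_measurable borel"
    using w H by (auto dest: borel_measurable_integrable)
  have dom: "integrable (lborel \<Otimes>\<^sub>M lborel) (\<lambda>(x, \<mu>). H x * norm (w \<mu>))"
    using w H by (intro lborel_pair.Fubini_integrable) (auto simp: case_prod_beta abs_mult)
  have f: "integrable (lborel \<Otimes>\<^sub>M lborel) (case_prod f)"
  proof (rule Bochner_Integration.integrable_bound[OF dom])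
    show "case_prod f \<in> borel_measurable (lborel \<Otimes>\<^sub>M lborel)"
      unfolding f_def by measurable
    have "norm (f x \<mu>) \<le> norm (H x * norm (w \<mu>))" for x \<mu>
    proof (cases "x \<in> X \<and> \<mu> \<in> {\<nu>0..\<nu>}")
      case True
      then have "norm (k x \<mu>) \<le> \<bar>h x\<bar>"
        using le[of x \<mu>] by auto
      then have "norm (w \<mu>) * norm (k x \<mu>) \<le> norm (w \<mu>) * \<bar>h x\<bar>"
        by (intro mult_left_mono) auto
      then show ?thesis
        using True by (simp add: f_def H_def norm_mult abs_mult mult.commute)
    qed (auto simp: f_def H_def w_def)
    then show "AE p in lborel \<Otimes>\<^sub>M lborel. norm (case_prod f p) \<le> norm (case p of (x, \<mu>) \<Rightarrow> H x * norm (w \<mu>))"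
      by auto
  qed
  \<comment> \<open>\<open>Gamma\<close> has the default value 0 at its poles;
    \<open>Re \<alpha> > 0\<close> excludes them, so the normalising factor can be
    cancelled.\<close>
  have G: "Gamma \<alpha> \<noteq> 0"
    using assms(1) by (auto simp: Gamma_eq_zero_iff elim!: nonpos_Ints_cases)
  have inner: "(\<integral>x. f x \<mu> \<partial>lborel) = indicator {\<nu>0..\<nu>} \<mu> *\<^sub>R (of_real (\<nu> - \<mu>) powr (\<alpha> - 1) * (LBINT x:X. k x \<mu>))" for \<mu>
  proof -
    have "(\<integral>x. f x \<mu> \<partial>lborel) = w \<mu> * (LBINT x:X. k x \<mu>)"
      by (simp only: f_def set_lebesgue_integral_def integral_mult_right_zero)
    then show ?thesis by (simp add: w_def)
  qed
  have outer: "(\<integral>\<mu>. f x \<mu> \<partial>lborel) = Gamma \<alpha> * (indicator X x *\<^sub>R frac_integral \<nu>0 \<alpha> (k x) \<nu>)" for x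
  proof -
    have "(\<integral>\<mu>. f x \<mu> \<partial>lborel) = (\<integral>\<mu>. indicator X x *\<^sub>R (indicator {\<nu>0..\<nu>} \<mu> *\<^sub>R (of_real (\<nu> - \<mu>) powr (\<alpha> - 1) * k x \<mu>)) \<partial>lborel)"
      by (intro Bochner_Integration.integral_cong) (auto simp: f_def w_def)
    also have "\<dots> = indicator X x *\<^sub>R (Gamma \<alpha> * frac_integral \<nu>0 \<alpha> (k x) \<nu>)"
      using G by (simp only: integral_scaleR_right) (simp add: frac_integral_def set_lebesgue_integral_def)
    finally show ?thesis by simp
  qed
  have "integrable lborel (\<lambda>x. 1 / Gamma \<alpha> * (\<integral>\<mu>. f x \<mu> \<partial>lborel))"
    using lborel_pair.integrable_fst'[OF f] by (intro integrable_mult_right) simp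
  then show "set_integrable lborel X (\<lambda>x. frac_integral \<nu>0 \<alpha> (k x) \<nu>)"
    using G by (simp add: outer set_integrable_def)
  have "integrable lborel (\<lambda>\<mu>. \<integral>x. f x \<mu> \<partial>lborel)"
    using lborel_pair.integrable_snd[OF f] by simp
  then show "set_integrable lborel {\<nu>0..\<nu>} (\<lambda>\<mu>. of_real (\<nu> - \<mu>) powr (\<alpha> - 1) * (LBINT x:X. k x \<mu>))"
    by (simp add: inner set_integrable_def)
  have "(\<integral>\<mu>. (\<integral>x. f x \<mu> \<partial>lborel) \<partial>lborel) = (\<integral>x. (\<integral>\<mu>. f x \<mu> \<partial>lborel) \<partial>lborel)"
    by (rule lborel_pair.Fubini_integral[OF f])
  then have "(LBINT \<mu>:{\<nu>0..\<nu>}. of_real (\<nu> - \<mu>) powr (\<alpha> - 1) * (LBINT x:X. k x \<mu>)) =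
      Gamma \<alpha> * (LBINT x:X. frac_integral \<nu>0 \<alpha> (k x) \<nu>)"
    by (simp only: inner outer set_lebesgue_integral_def integral_mult_right_zero)
  then show "frac_integral \<nu>0 \<alpha> (\<lambda>\<mu>. LBINT x:X. k x \<mu>) \<nu> = (LBINT x:X. frac_integral \<nu>0 \<alpha> (k x) \<nu>)"
    using G by (subst frac_integral_def) simp
qed

lemma frac_integral_mult_left:
  "frac_integral \<nu>0 \<alpha> (\<lambda>\<mu>. c * f \<mu>) \<nu> = c * frac_integral \<nu>0 \<alpha> f \<nu>"
  unfolding frac_integral_def by (subst mult.left_commute) simp

lemma frac_integral_add:
  assumes "set_integrable lborel {\<nu>0..\<nu>} (\<lambda>\<mu>. of_real (\<nu> - \<mu>) powr (\<alpha> - 1) * f \<mu>)"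
    and "set_integrable lborel {\<nu>0..\<nu>} (\<lambda>\<mu>. of_real (\<nu> - \<mu>) powr (\<alpha> - 1) * g \<mu>)"
  shows "frac_integral \<nu>0 \<alpha> (\<lambda>\<mu>. f \<mu> + g \<mu>) \<nu> = frac_integral \<nu>0 \<alpha> f \<nu> + frac_integral \<nu>0 \<alpha> g \<nu>"
  using assms by (simp add: frac_integral_def distrib_left set_integral_add(2))

lemma frac_integral_diff:
  assumes "set_integrable lborel {\<nu>0..\<nu>} (\<lambda>\<mu>. of_real (\<nu> - \<mu>) powr (\<alpha> - 1) * f \<mu>)"
    and "set_integrable lborel {\<nu>0..\<nu>} (\<lambda>\<mu>. of_real (\<nu> - \<mu>) powr (\<alpha> - 1) * g \<mu>)"
  shows "frac_integral \<nu>0 \<alpha> (\<lambda>\<mu>. f \<mu> - g \<mu>) \<nu> = frac_integral \<nu>0 \<alpha> f \<nu> - frac_integral \<nu>0 \<alpha> g \<nu>"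
  using assms by (simp add: frac_integral_def right_diff_distrib set_integral_diff(2) diff_divide_distrib)

lemma frac_integral_cong_countable:
  assumes "countable N" "\<And>\<mu>. \<mu> \<notin> N \<Longrightarrow> f \<mu> = g \<mu>"
  shows "frac_integral \<nu>0 \<alpha> f \<nu> = frac_integral \<nu>0 \<alpha> g \<nu>"
  unfolding frac_integral_def set_lebesgue_integral_def
  using integral_discrete_difference[OF assms(1), of lborel
      "\<lambda>\<mu>. indicator {\<nu>0..\<nu>} \<mu> *\<^sub>R (of_real (\<nu> - \<mu>) powr (\<alpha> - 1) * f \<mu>)"
      "\<lambda>\<mu>. indicator {\<nu>0..\<nu>} \<mu> *\<^sub>R (of_real (\<nu> - \<mu>) powr (\<alpha> - 1) * g \<mu>)"] assms(2)
  by simp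

section \<open>Conjugation, real and imaginary parts\<close>

lemma cnj_of_real_powr:
  "s \<ge> 0 \<Longrightarrow> cnj (of_real s powr a) = of_real s powr cnj a"
  by (subst cnj_powr) auto

text \<open>On the segment the base nu - mu is nonnegative, so conjugating the power conjugates just
  its exponent and restores \<alpha>; \<open>Gamma\<close> commutes with conjugation.\<close>

lemma cnj_frac_integral:
  "cnj (frac_integral \<nu>0 (cnj \<alpha>) f \<nu>) = frac_integral \<nu>0 \<alpha> (\<lambda>\<mu>. cnj (f \<mu>)) \<nu>"
proof -
  have "cnj (LBINT \<mu>:{\<nu>0..\<nu>}. of_real (\<nu> - \<mu>) powr (cnj \<alpha> - 1) * f \<mu>) =
      (LBINT \<mu>:{\<nu>0..\<nu>}. cnj (of_real (\<nu> - \<mu>) powr (cnj \<alpha> - 1) * f \<mu>))"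
    unfolding set_lebesgue_integral_def by (subst Bochner_Integration.integral_cnj[symmetric]) (simp only: complex_cnj_scaleR)
  also have "\<dots> = (LBINT \<mu>:{\<nu>0..\<nu>}. of_real (\<nu> - \<mu>) powr (\<alpha> - 1) * cnj (f \<mu>))"
  proof (intro set_lebesgue_integral_cong allI impI)
    fix \<mu> assume "\<mu> \<in> {\<nu>0..\<nu>}"
    then have "cnj (of_real (\<nu> - \<mu>) powr (cnj \<alpha> - 1)) = of_real (\<nu> - \<mu>) powr cnj (cnj \<alpha> - 1)"
      by (intro cnj_of_real_powr) auto
    then show "cnj (of_real (\<nu> - \<mu>) powr (cnj \<alpha> - 1) * f \<mu>) = of_real (\<nu> - \<mu>) powr (\<alpha> - 1) * cnj (f \<mu>)"
      by (simp only: complex_cnj_mult complex_cnj_diff complex_cnj_cnj complex_cnj_one)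
  qed auto
  finally show ?thesis
    by (simp add: frac_integral_def cnj_Gamma)
qed

lemma set_integrable_frac_kernel:
  assumes "Re \<alpha> > 0" "\<nu>0 \<le> \<nu>" "continuous_on {\<nu>0..\<nu>} f"
  shows "set_integrable lborel {\<nu>0..\<nu>} (\<lambda>\<mu>. of_real (\<nu> - \<mu>) powr (\<alpha> - 1) * f \<mu>)"
  using assms by (intro set_integrable_mult_continuous set_integrable_of_real_powr_diff)

text \<open>For non-real \<alpha> the kernel is not real, so the ordinary real part would not pass
  through it. The conjugate taken at the conjugate order acts on \<open>f\<close> alone.\<close>

lemma ext_Re_frac_integral:
  assumes "Re \<alpha> > 0" "\<nu>0 \<le> \<nu>" "continuous_on {\<nu>0..\<nu>} f"
  shows "ext_Re (\<lambda>a. frac_integral \<nu>0 a f \<nu>) \<alpha> = frac_integral \<nu>0 \<alpha> (\<lambda>\<mu>. of_real (Re (f \<mu>))) \<nu>"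
proof -
  have "(\<lambda>\<mu>. complex_of_real (Re (f \<mu>))) = (\<lambda>\<mu>. 1 / 2 * (f \<mu> + cnj (f \<mu>)))"
    by (auto simp: complex_eq_iff fun_eq_iff)
  then have "frac_integral \<nu>0 \<alpha> (\<lambda>\<mu>. of_real (Re (f \<mu>))) \<nu> =
      1 / 2 * (frac_integral \<nu>0 \<alpha> f \<nu> + frac_integral \<nu>0 \<alpha> (\<lambda>\<mu>. cnj (f \<mu>)) \<nu>)"
    using assms
    by (simp only: frac_integral_mult_left
        frac_integral_add[OF set_integrable_frac_kernel set_integrable_frac_kernel] continuous_on_cnj)
  then show ?thesis
    by (simp add: ext_Re_def cnj_frac_integral)
qed

lemma ext_Im_frac_integral:
  assumes "Re \<alpha> > 0" "\<nu>0 \<le> \<nu>" "continuous_on {\<nu>0..\<nu>} f"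
  shows "ext_Im (\<lambda>a. frac_integral \<nu>0 a f \<nu>) \<alpha> = frac_integral \<nu>0 \<alpha> (\<lambda>\<mu>. of_real (Im (f \<mu>))) \<nu>"
proof -
  have "(\<lambda>\<mu>. complex_of_real (Im (f \<mu>))) = (\<lambda>\<mu>. 1 / (2 * \<i>) * (f \<mu> - cnj (f \<mu>)))"
    by (auto simp: complex_eq_iff fun_eq_iff)
  then have "frac_integral \<nu>0 \<alpha> (\<lambda>\<mu>. of_real (Im (f \<mu>))) \<nu> =
      1 / (2 * \<i>) * (frac_integral \<nu>0 \<alpha> f \<nu> - frac_integral \<nu>0 \<alpha> (\<lambda>\<mu>. cnj (f \<mu>)) \<nu>)"
    using assms
    by (simp only: frac_integral_mult_left
        frac_integral_diff[OF set_integrable_frac_kernel set_integrable_frac_kernel] continuous_on_cnj)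
  then show ?thesis
    by (simp add: ext_Im_def cnj_frac_integral)
qed

section \<open>Fractional integrals of the kernels of Y\<close>

text \<open>\<open>\<theta>\<close> will be t sin x, which does not involve the order. Since -ix has
  argument -pi/2, x^a / (-ix)^a = e^(i pi a / 2): this is the origin of the phase pi \<alpha> / 2.
  The power of the positive number x commutes with \<open>ext_Im\<close> and so can stand outside as
  x^(-\<alpha>).\<close>

lemma frac_integral_sin_kernel:
  fixes \<alpha> :: complex and \<nu>0 \<nu> \<theta> x :: real
  assumes "Re \<alpha> > 0" "\<nu>0 \<le> \<nu>" "x > 0"
  shows "frac_integral \<nu>0 \<alpha> (\<lambda>\<mu>. of_real (sin (\<theta> - \<mu> * x))) \<nu> = of_real x powr (- \<alpha>) *
    ext_Im (\<lambda>a. exp (\<i> * (of_real (\<theta> - \<nu> * x) + of_real pi * a / 2)) *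
                        reg_lower_gamma a (- \<i> * of_real (x * (\<nu> - \<nu>0)))) \<alpha>"
proof -
  define f where "f \<mu> = exp (\<i> * of_real \<theta>) * exp (- \<i> * of_real x * of_real \<mu>)" for \<mu> :: real
  have F: "exp (\<i> * (of_real (\<theta> - \<nu> * x) + of_real pi * a / 2)) * reg_lower_gamma a (- \<i> * of_real (x * (\<nu> - \<nu>0))) =
      of_real x powr a * frac_integral \<nu>0 a f \<nu>" if "Re a > 0" for a
  proof -
    have c: "- \<i> * complex_of_real x \<noteq> 0"
      using assms by simp
    have "Ln (- \<i> * complex_of_real x) = of_real (ln x) - \<i> * of_real pi / 2"
      using Ln_times_of_real[of x "- \<i>"] assms by (simp add: mult.commute Ln_of_real)
    then have "of_real x powr a / (- \<i> * complex_of_real x) powr a =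
        exp (a * of_real (ln x) - a * (of_real (ln x) - \<i> * of_real pi / 2))"
      using assms by (simp only: powr_def c exp_diff[symmetric] if_False Ln_of_real of_real_eq_0_iff) (simp add: exp_diff)
    then have quot: "of_real x powr a / (- \<i> * complex_of_real x) powr a = exp (\<i> * of_real pi * a / 2)"
      by (simp add: algebra_simps)
    have "of_real x powr a * frac_integral \<nu>0 a f \<nu> = of_real x powr a * (exp (\<i> * of_real \<theta>) * (exp (- \<i> * of_real x * of_real \<nu>) *
       (reg_lower_gamma a (- \<i> * of_real (x * (\<nu> - \<nu>0))) / (- \<i> * complex_of_real x) powr a)))"
      using frac_integral_exp[OF that assms(2) c]
      by (simp only: f_def[abs_def] frac_integral_mult_left of_real_mult mult.assoc)
    also have "\<dots> = exp (\<i> * of_real \<theta>) * exp (- \<i> * of_real x * of_real \<nu>) *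
        (of_real x powr a / (- \<i> * complex_of_real x) powr a) * reg_lower_gamma a (- \<i> * of_real (x * (\<nu> - \<nu>0)))"
      by (simp only: times_divide_eq_left times_divide_eq_right ac_simps)
    also have "exp (\<i> * of_real \<theta>) * exp (- \<i> * of_real x * of_real \<nu>) *
        (of_real x powr a / (- \<i> * complex_of_real x) powr a) =
        exp (\<i> * (of_real (\<theta> - \<nu> * x) + of_real pi * a / 2))"
      unfolding quot by (simp add: algebra_simps flip: exp_add)
    finally show ?thesis by (rule sym)
  qed
  have "Im (f \<mu>) = sin (\<theta> - \<mu> * x)" for \<mu>
  proof -
    have "f \<mu> = exp (\<i> * of_real (\<theta> - \<mu> * x))"
      by (simp add: f_def algebra_simps flip: exp_add)
    then show ?thesis by (simp add: Im_exp)
  qed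
  moreover have "ext_Im (\<lambda>a. of_real x powr a * frac_integral \<nu>0 a f \<nu>) \<alpha> =
      of_real x powr \<alpha> * ext_Im (\<lambda>a. frac_integral \<nu>0 a f \<nu>) \<alpha>"
    using assms(3) by (simp add: ext_Im_def cnj_of_real_powr right_diff_distrib diff_divide_distrib mult.left_commute)
  moreover have "ext_Im (\<lambda>a. frac_integral \<nu>0 a f \<nu>) \<alpha> = frac_integral \<nu>0 \<alpha> (\<lambda>\<mu>. of_real (Im (f \<mu>))) \<nu>"
    using assms unfolding f_def by (intro ext_Im_frac_integral continuous_intros)
  ultimately have "ext_Im (\<lambda>a. of_real x powr a * frac_integral \<nu>0 a f \<nu>) \<alpha> =
      of_real x powr \<alpha> * frac_integral \<nu>0 \<alpha> (\<lambda>\<mu>. of_real (sin (\<theta> - \<mu> * x))) \<nu>"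
    by simp
  moreover have "ext_Im (\<lambda>a. exp (\<i> * (of_real (\<theta> - \<nu> * x) + of_real pi * a / 2)) *
                        reg_lower_gamma a (- \<i> * of_real (x * (\<nu> - \<nu>0)))) \<alpha> =
      ext_Im (\<lambda>a. of_real x powr a * frac_integral \<nu>0 a f \<nu>) \<alpha>"
  proof -
    \<comment> \<open>\<open>ext_Im\<close> evaluates its argument at \<open>\<alpha>\<close> and at
      \<open>cnj \<alpha>\<close>, so \<open>F\<close> is needed at both.\<close>
    have "Re (cnj \<alpha>) > 0" using assms(1) by simp
    then show ?thesis by (simp only: ext_Im_def F[OF assms(1)] F)
  qed
  ultimately show ?thesis
    using assms(3) by (simp add: powr_minus)
qed

text \<open>The oscillating term is the real part of e^(c mu) with c = i pi - x. This c is not real,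
  so conjugation changes the base of c^a and the power has to stay inside
  \<open>ext_Re\<close>.\<close>

lemma frac_integral_exp_kernel:
  fixes \<alpha> :: complex and \<nu>0 \<nu> x :: real
  assumes "Re \<alpha> > 0" "\<nu>0 \<le> \<nu>" "x > 0"
  shows "frac_integral \<nu>0 \<alpha> (\<lambda>\<mu>. of_real (exp (\<mu> * x) + cos (pi * \<mu>) * exp (- \<mu> * x))) \<nu> =
     of_real (exp (\<nu> * x)) * (reg_lower_gamma \<alpha> (of_real (x * (\<nu> - \<nu>0))) / of_real x powr \<alpha>)
     + ext_Re (\<lambda>a. exp ((\<i> * of_real pi - of_real x) * of_real \<nu>) *
          (reg_lower_gamma a ((\<i> * of_real pi - of_real x) * of_real (\<nu> - \<nu>0)) /
           (\<i> * of_real pi - of_real x) powr a)) \<alpha>"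
proof -
  define c where "c = \<i> * of_real pi - complex_of_real x"
  define f where "f \<mu> = exp (c * of_real \<mu>)" for \<mu> :: real
  have c: "c \<noteq> 0"
    by (simp add: c_def complex_eq_iff)
  have cont: "continuous_on {\<nu>0..\<nu>} f"
    unfolding f_def by (intro continuous_intros)
  have "(\<lambda>\<mu>. complex_of_real (exp (\<mu> * x) + cos (pi * \<mu>) * exp (- \<mu> * x))) =
      (\<lambda>\<mu>. exp (of_real x * of_real \<mu>) + of_real (Re (f \<mu>)))"
  proof
    fix \<mu>
    have "Re (f \<mu>) = cos (pi * \<mu>) * exp (- \<mu> * x)"
      by (simp add: f_def c_def Re_exp mult.commute)
    moreover have "complex_of_real (exp (\<mu> * x)) = exp (of_real x * of_real \<mu>)"
      by (simp add: exp_of_real mult.commute flip: of_real_mult)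
    ultimately show "complex_of_real (exp (\<mu> * x) + cos (pi * \<mu>) * exp (- \<mu> * x)) =
      exp (of_real x * of_real \<mu>) + of_real (Re (f \<mu>))"
      by (simp only: of_real_add)
  qed
  then have "frac_integral \<nu>0 \<alpha> (\<lambda>\<mu>. of_real (exp (\<mu> * x) + cos (pi * \<mu>) * exp (- \<mu> * x))) \<nu> =
      frac_integral \<nu>0 \<alpha> (\<lambda>\<mu>. exp (of_real x * of_real \<mu>)) \<nu> + frac_integral \<nu>0 \<alpha> (\<lambda>\<mu>. of_real (Re (f \<mu>))) \<nu>"
    using assms cont
    by (simp only:) (intro frac_integral_add set_integrable_frac_kernel continuous_intros; simp)
  also have "frac_integral \<nu>0 \<alpha> (\<lambda>\<mu>. exp (of_real x * of_real \<mu>)) \<nu> =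
      of_real (exp (\<nu> * x)) * (reg_lower_gamma \<alpha> (of_real (x * (\<nu> - \<nu>0))) / of_real x powr \<alpha>)"
  proof -
    have "exp (complex_of_real x * of_real \<nu>) = of_real (exp (\<nu> * x))"
      by (simp add: exp_of_real mult.commute flip: of_real_mult)
    then show ?thesis
      using frac_integral_exp[OF assms(1,2), of "of_real x"] assms(3) by simp
  qed
  also have "frac_integral \<nu>0 \<alpha> (\<lambda>\<mu>. of_real (Re (f \<mu>))) \<nu> = ext_Re (\<lambda>a. frac_integral \<nu>0 a f \<nu>) \<alpha>"
    using ext_Re_frac_integral[OF assms(1,2) cont] by simp
  also have "\<dots> = ext_Re (\<lambda>a. exp (c * of_real \<nu>) * (reg_lower_gamma a (c * of_real (\<nu> - \<nu>0)) / c powr a)) \<alpha>"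
    using assms(1) by (simp add: ext_Re_def f_def[abs_def] frac_integral_exp[OF _ assms(2) c])
  finally show ?thesis
    by (simp only: c_def)
qed

text \<open>The left side is holomorphic in \<alpha>, while literal real and imaginary parts are
  not. Hence the literal formula is stated for real \<alpha> and the extended one for all \<alpha>;
  the former is a specialisation of the latter.\<close>

theorem mainTheorem10:
  fixes \<alpha> :: complex and \<nu>0 \<nu> t :: real
  assumes "Re \<alpha> > 0" and "\<nu>0 \<le> \<nu>" and "t > 0"
  shows
    "(\<alpha> \<in> \<real> \<longrightarrow>
       frac_integral \<nu>0 \<alpha> (\<lambda>\<mu>. bessel_Y (of_real \<mu>) t) \<nu> =
       1 / of_real pi *
        ((LBINT x:{0..pi}. of_real x powr (- \<alpha>) *
            of_real (Im (exp (\<i> * (of_real (t * sin x - \<nu> * x) + of_real pi * \<alpha> / 2)) *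
                         reg_lower_gamma \<alpha> (- \<i> * of_real (x * (\<nu> - \<nu>0))))))
         - (LBINT x:{0..}. of_real (exp (- t * sinh x)) *
             (of_real (exp (\<nu> * x)) *
                (reg_lower_gamma \<alpha> (of_real (x * (\<nu> - \<nu>0))) / of_real x powr \<alpha>)
              + of_real (Re (exp ((\<i> * of_real pi - of_real x) * of_real \<nu>) *
                  (reg_lower_gamma \<alpha> ((\<i> * of_real pi - of_real x) * of_real (\<nu> - \<nu>0)) /
                   (\<i> * of_real pi - of_real x) powr \<alpha>)))))))
     \<and>
       frac_integral \<nu>0 \<alpha> (\<lambda>\<mu>. bessel_Y (of_real \<mu>) t) \<nu> =
       1 / of_real pi *
        ((LBINT x:{0..pi}. of_real x powr (- \<alpha>) *
            ext_Im (\<lambda>a. exp (\<i> * (of_real (t * sin x - \<nu> * x) + of_real pi * a / 2)) *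
                        reg_lower_gamma a (- \<i> * of_real (x * (\<nu> - \<nu>0)))) \<alpha>)
         - (LBINT x:{0..}. of_real (exp (- t * sinh x)) *
             (of_real (exp (\<nu> * x)) *
                (reg_lower_gamma \<alpha> (of_real (x * (\<nu> - \<nu>0))) / of_real x powr \<alpha>)
              + ext_Re (\<lambda>a. exp ((\<i> * of_real pi - of_real x) * of_real \<nu>) *
                  (reg_lower_gamma a ((\<i> * of_real pi - of_real x) * of_real (\<nu> - \<nu>0)) /
                   (\<i> * of_real pi - of_real x) powr a)) \<alpha>)))"
    (is "(_ \<longrightarrow> _) \<and> ?lhs = 1 / of_real pi * ((LBINT x:_. ?A x) - (LBINT x:_. ?B x))")
proof -
  define K where "K x \<mu> = complex_of_real (sin (t * sin x - \<mu> * x))" for x \<mu>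
  define k where "k x \<mu> = exp (\<mu> * x) + cos (pi * \<mu>) * exp (- \<mu> * x)" for x \<mu> :: real
  define E where "E x \<mu> = complex_of_real (exp (- t * sinh x)) * of_real (k x \<mu>)" for x \<mu>
  \<comment> \<open>M bounds the absolute value of all orders on the segment. Both exponentials in
    \<open>k\<close> are then at most exp(M x), which gives the majorant 2 exp(M x - t sinh x),
    uniform in mu.\<close>
  define M where "M = max \<bar>\<nu>0\<bar> \<bar>\<nu>\<bar>"
  have Y: "bessel_Y (of_real \<mu>) t = 1 / of_real pi * ((LBINT x:{0..pi}. K x \<mu>) - (LBINT x:{0..}. E x \<mu>))"
    if "\<mu> \<notin> \<int>" for \<mu>
  proof -
    have "(LBINT x:{0..pi}. K x \<mu>) = of_real (LBINT x:{0..pi}. sin (t * sin x - \<mu> * x))"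
      by (simp only: K_def set_integral_complex_of_real)
    moreover have "(LBINT x:{0..}. E x \<mu>) = of_real (LBINT x:{0..}. exp (- t * sinh x) * (exp (\<mu> * x) + cos (pi * \<mu>) * exp (- \<mu> * x)))"
      by (simp only: E_def k_def of_real_mult[symmetric] set_integral_complex_of_real)
    ultimately show ?thesis
      using bessel_Y_Schlaefli[OF that assms(3)] by simp
  qed
  have K_meas: "case_prod K \<in> borel_measurable (borel \<Otimes>\<^sub>M borel)"
    unfolding K_def by measurable
  have "set_integrable lborel {0..pi} (\<lambda>x. 1 :: real)"
    by (intro borel_integrable_atLeastAtMost' continuous_intros)
  note swap_K = frac_integral_swap[OF assms(1,2) _ K_meas this]
  have K_le: "norm (K x \<mu>) \<le> 1" for x \<mu>
    by (simp add: K_def)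
  have "sinh \<in> borel_measurable (borel :: real measure)"
    by (intro borel_measurable_continuous_onI continuous_intros)
  then have E_meas: "case_prod E \<in> borel_measurable (borel \<Otimes>\<^sub>M borel)"
    unfolding E_def k_def by measurable
  have "set_integrable lborel {0..} (\<lambda>x. 2 * exp (M * x - t * sinh x))"
    using assms(3) by (intro set_integrable_mult_right integrable_sinh_kernel)
  note swap_E = frac_integral_swap[OF assms(1,2) _ E_meas this]
  have E_le: "norm (E x \<mu>) \<le> 2 * exp (M * x - t * sinh x)" if "x \<in> {0..}" "\<mu> \<in> {\<nu>0..\<nu>}" for x \<mu>
  proof -
    have "\<mu> \<le> M" "- \<mu> \<le> M"
      using that by (auto simp: M_def)
    then have "\<mu> * x \<le> M * x" "- \<mu> * x \<le> M * x"
      using that by (intro mult_right_mono; simp)+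
    have "\<bar>k x \<mu>\<bar> \<le> \<bar>exp (\<mu> * x)\<bar> + \<bar>cos (pi * \<mu>) * exp (- \<mu> * x)\<bar>"
      unfolding k_def by (rule abs_triangle_ineq)
    also have "\<bar>cos (pi * \<mu>) * exp (- \<mu> * x)\<bar> \<le> exp (- \<mu> * x)"
      by (simp add: abs_mult mult_left_le_one_le)
    also have "\<bar>exp (\<mu> * x)\<bar> + exp (- \<mu> * x) \<le> exp (M * x) + exp (M * x)"
      using \<open>\<mu> * x \<le> M * x\<close> \<open>- \<mu> * x \<le> M * x\<close> by (intro add_mono) auto
    finally have "\<bar>k x \<mu>\<bar> \<le> 2 * exp (M * x)"
      by simp
    then have "exp (- t * sinh x) * \<bar>k x \<mu>\<bar> \<le> exp (- t * sinh x) * (2 * exp (M * x))"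
      by (intro mult_left_mono) auto
    also have "\<dots> = 2 * exp (M * x - t * sinh x)"
      by (simp add: exp_diff exp_minus field_simps)
    finally show ?thesis
      by (simp add: E_def norm_mult)
  qed
  have "?lhs = frac_integral \<nu>0 \<alpha> (\<lambda>\<mu>. 1 / of_real pi * ((LBINT x:{0..pi}. K x \<mu>) - (LBINT x:{0..}. E x \<mu>))) \<nu>"
    by (rule frac_integral_cong_countable[of "\<int>"]) (use Y in \<open>auto simp: countable_int\<close>)
  also have "\<dots> = 1 / of_real pi * (frac_integral \<nu>0 \<alpha> (\<lambda>\<mu>. LBINT x:{0..pi}. K x \<mu>) \<nu> -
      frac_integral \<nu>0 \<alpha> (\<lambda>\<mu>. LBINT x:{0..}. E x \<mu>) \<nu>)"
    unfolding frac_integral_mult_left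
    by (subst frac_integral_diff[OF swap_K(3) swap_E(3)]) (auto intro: K_le E_le)
  also have "frac_integral \<nu>0 \<alpha> (\<lambda>\<mu>. LBINT x:{0..pi}. K x \<mu>) \<nu> = (LBINT x:{0..pi}. frac_integral \<nu>0 \<alpha> (K x) \<nu>)"
    by (rule swap_K(1)) (auto intro: K_le)
  also have "frac_integral \<nu>0 \<alpha> (\<lambda>\<mu>. LBINT x:{0..}. E x \<mu>) \<nu> = (LBINT x:{0..}. frac_integral \<nu>0 \<alpha> (E x) \<nu>)"
    by (rule swap_E(1)) (auto intro: E_le)
  also have "(LBINT x:{0..pi}. frac_integral \<nu>0 \<alpha> (K x) \<nu>) = (LBINT x:{0..pi}. ?A x)"
    unfolding set_lebesgue_integral_def
  \<comment> \<open>The closed forms divide by powers of x and hold for x > 0 only; the point 0 is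
    dropped as a null set.\<close>
  proof (rule integral_discrete_difference[of "{0}"])
    fix x :: real assume "x \<notin> {0}"
    show "indicator {0..pi} x *\<^sub>R frac_integral \<nu>0 \<alpha> (K x) \<nu> = indicator {0..pi} x *\<^sub>R ?A x"
    proof (cases "x > 0")
      case True
      then show ?thesis
        unfolding K_def by (simp only: frac_integral_sin_kernel[OF assms(1,2) True])
    qed (use \<open>x \<notin> {0}\<close> in auto)
  qed auto
  also have "(LBINT x:{0..}. frac_integral \<nu>0 \<alpha> (E x) \<nu>) = (LBINT x:{0..}. ?B x)"
    unfolding set_lebesgue_integral_def
  proof (rule integral_discrete_difference[of "{0}"])
    fix x :: real assume "x \<notin> {0}"
    show "indicator {0..} x *\<^sub>R frac_integral \<nu>0 \<alpha> (E x) \<nu> = indicator {0..} x *\<^sub>R ?B x"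
    proof (cases "x > 0")
      case True
      then show ?thesis
        unfolding E_def k_def frac_integral_mult_left
        by (simp only: frac_integral_exp_kernel[OF assms(1,2) True])
    qed (use \<open>x \<notin> {0}\<close> in auto)
  qed auto
  finally have *: "?lhs = 1 / of_real pi * ((LBINT x:{0..pi}. ?A x) - (LBINT x:{0..}. ?B x))" .
  then show ?thesis
    by (auto simp only: ext_Re_real ext_Im_real)
qed

end
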